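(* A homology sphere is $1$-stellated if and only if it is $1$-stacked.
   Context: Simplicial complexes are finite and contain the empty set as a face. For a finite set $\alpha$, $\overline{\alpha}$ is the complex of all subsets of $\alpha$, $\partial\alpha$ the complex of all proper subsets, and $\dim(\alpha)=\#(\alpha)-1$; $\ast$ denotes join. The standard sphere $S^d_{d+2}$ is the boundary complex of a $(d+1)$-simplex. Bistellar moves: let $X$ be $d$-dimensional and $\alpha,\beta$ disjoint non-empty finite sets with $\dim(\alpha)+\dim(\beta)=d$ such that the induced subcomplex of $X$ on $\alpha\sqcup\beta$ is $\overline{\alpha}\ast\partial\beta$ (if $\beta$ is a single vertex this means $\beta$ is a new vertex not in $X$). The complex $(X\setminus(\overline{\alpha}\ast\partial\beta))\cup(\partial\alpha\ast\overline{\beta})$ is obtained from $X$ by the bistellar move $\alpha\mapsto\beta$, of index $\dim(\beta)$. For $0\le k\le d+1$, a $d$-dimensional complex is $k$-stellated if it is obtained from $S^d_{d+2}$ by a finite (possibly empty) sequence of bistellar moves each of index $<k$. A homology sphere/ball means an $\mathbb{F}$-homology sphere/ball for some field $\mathbb{F}$. An $\mathbb{F}$-homology $d$-sphere is a $d$-dimensional complex in which the link of every face $\sigma$ (including $\emptyset$) has the reduced $\mathbb{F}$-homology of a $(d-\dim(\sigma)-1)$-sphere. An $\mathbb{F}$-homology $d$-ball is a $d$-dimensional $\mathbb{F}$-acyclic complex in which the link of every non-empty face $\sigma$ has the reduced homology of a $(d-\dim(\sigma)-1)$-sphere or of a point, and whose faces with acyclic link form an $\mathbb{F}$-homology $(d-1)$-sphere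 (its boundary). A homology $(d+1)$-ball is $k$-stacked if all its faces of codimension at least $k+1$ (dimension $\le d-k$) lie in its boundary; a homology $d$-sphere is $k$-stacked if it is the boundary of a $k$-stacked homology $(d+1)$-ball. *)

theory Defs
  imports "HOL-Algebra.AbelCoset" "HOL-Algebra.Module"
begin

section \<open>Simplicial complexes\<close>

definition simplicial_complex :: "'a set set \<Rightarrow> bool" where
  "simplicial_complex X \<longleftrightarrow>
     finite X \<and> {} \<in> X \<and> (\<forall>\<sigma>\<in>X. finite \<sigma> \<and> (\<forall>\<tau>. \<tau> \<subseteq> \<sigma> \<longrightarrow> \<tau> \<in> X))"

definition face_dim :: "'a set \<Rightarrow> int" where
  "face_dim \<sigma> = int (card \<sigma>) - 1"

definition complex_dim :: "'a set set \<Rightarrow> int" where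
  "complex_dim X = Max (face_dim ` X)"

definition simplex :: "'a set \<Rightarrow> 'a set set" where
  "simplex \<alpha> = {\<sigma>. \<sigma> \<subseteq> \<alpha>}"

definition simplex_boundary :: "'a set \<Rightarrow> 'a set set" where
  "simplex_boundary \<alpha> = {\<sigma>. \<sigma> \<subset> \<alpha>}"

definition join :: "'a set set \<Rightarrow> 'a set set \<Rightarrow> 'a set set" where
  "join X Y = {\<sigma> \<union> \<tau> | \<sigma> \<tau>. \<sigma> \<in> X \<and> \<tau> \<in> Y}"

definition induced :: "'a set set \<Rightarrow> 'a set \<Rightarrow> 'a set set" where
  "induced X A = {\<sigma> \<in> X. \<sigma> \<subseteq> A}"

definition link :: "'a set \<Rightarrow> 'a set set \<Rightarrow> 'a set set" where
  "link \<sigma> X = {\<tau> \<in> X. \<tau> \<inter> \<sigma> = {} \<and> \<tau> \<union> \<sigma> \<in> X}"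


section \<open>Bistellar moves\<close>

text \<open>If \<open>\<beta>\<close> is a single vertex, the condition on the induced subcomplex says that
  \<open>\<alpha>\<close> is a face and that the vertex in \<open>\<beta>\<close> is new.\<close>

definition bistellar_move :: "'a set \<Rightarrow> 'a set \<Rightarrow> 'a set set \<Rightarrow> 'a set set \<Rightarrow> bool" where
  "bistellar_move \<alpha> \<beta> X Y \<longleftrightarrow>
     simplicial_complex X \<and>
     finite \<alpha> \<and> finite \<beta> \<and> \<alpha> \<noteq> {} \<and> \<beta> \<noteq> {} \<and> \<alpha> \<inter> \<beta> = {} \<and>
     face_dim \<alpha> + face_dim \<beta> = complex_dim X \<and>
     induced X (\<alpha> \<union> \<beta>) = join (simplex \<alpha>) (simplex_boundary \<beta>) \<and>
     Y = (X - join (simplex \<alpha>) (simplex_boundary \<beta>)) \<union> join (simplex_boundary \<alpha>) (simplex \<beta>)"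

definition stellated :: "int \<Rightarrow> int \<Rightarrow> 'a set set \<Rightarrow> bool" where
  "stellated k d X \<longleftrightarrow>
     0 \<le> k \<and> k \<le> d + 1 \<and>
     (\<exists>V. finite V \<and> face_dim V = d + 1 \<and>
          (\<lambda>Y Z. \<exists>\<alpha> \<beta>. bistellar_move \<alpha> \<beta> Y Z \<and> face_dim \<beta> < k)\<^sup>*\<^sup>* (simplex_boundary V) X)"


section \<open>Reduced simplicial homology over a field\<close>

text \<open>An \<open>i\<close>-chain of \<open>X\<close> is a function on faces that vanishes outside the
  \<open>i\<close>-dimensional faces of \<open>X\<close>. The empty face spans the chains of degree \<open>-1\<close>, so the
  homology below is the reduced one. The ring multiplication and unit of a \<^typ>\<open>('f, 'b) module\<close>
  record play no role for modules and are left \<^term>\<open>undefined\<close>.\<close>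

definition chains :: "'f ring \<Rightarrow> 'a set set \<Rightarrow> int \<Rightarrow> ('f, 'a set \<Rightarrow> 'f) module" where
  "chains F X i =
     \<lparr>carrier = {c. \<forall>\<sigma>. if \<sigma> \<in> X \<and> face_dim \<sigma> = i then c \<sigma> \<in> carrier F else c \<sigma> = \<zero>\<^bsub>F\<^esub>},
      mult = undefined, one = undefined,
      zero = (\<lambda>\<sigma>. \<zero>\<^bsub>F\<^esub>), add = (\<lambda>c c' \<sigma>. c \<sigma> \<oplus>\<^bsub>F\<^esub> c' \<sigma>),
      smult = (\<lambda>a c \<sigma>. a \<otimes>\<^bsub>F\<^esub> c \<sigma>)\<rparr>"

text \<open>Faces are oriented by the linear order of the vertices. The boundary of the face
  \<open>{v\<^sub>0 < \<dots> < v\<^sub>i}\<close> is the sum of the faces \<open>{v\<^sub>0, \<dots>, v\<^sub>i} - {v\<^sub>j}\<close> with signs \<open>(-1)\<^sup>j\<close>;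
  the definition gives the coefficient of \<open>\<tau>\<close> in the boundary of the chain \<open>c\<close>,
  so that \<open>j\<close> is the number of vertices of \<open>\<tau>\<close> below the vertex \<open>v\<close> removed.\<close>

definition chain_bd :: "'f ring \<Rightarrow> 'a::linorder set set \<Rightarrow> ('a set \<Rightarrow> 'f) \<Rightarrow> 'a set \<Rightarrow> 'f" where
  "chain_bd F X c =
     (\<lambda>\<tau>. \<Oplus>\<^bsub>F\<^esub>v\<in>\<Union>X - \<tau>.
        ((\<ominus>\<^bsub>F\<^esub> \<one>\<^bsub>F\<^esub>) [^]\<^bsub>F\<^esub> card {u \<in> \<tau>. u < v}) \<otimes>\<^bsub>F\<^esub> c (insert v \<tau>))"

definition cycles :: "'f ring \<Rightarrow> 'a::linorder set set \<Rightarrow> int \<Rightarrow> ('f, 'a set \<Rightarrow> 'f) module" where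
  "cycles F X i =
     (chains F X i)\<lparr>carrier := {c \<in> carrier (chains F X i). chain_bd F X c = \<zero>\<^bsub>chains F X (i - 1)\<^esub>}\<rparr>"

definition boundaries :: "'f ring \<Rightarrow> 'a::linorder set set \<Rightarrow> int \<Rightarrow> ('a set \<Rightarrow> 'f) set" where
  "boundaries F X i = chain_bd F X ` carrier (chains F X (i + 1))"

definition quotient_module :: "('f, 'b) module \<Rightarrow> 'b set \<Rightarrow> ('f, 'b set) module" where
  "quotient_module M N =
     \<lparr>carrier = a_rcosets\<^bsub>M\<^esub> N, mult = undefined, one = undefined,
      zero = N, add = set_add M,
      smult = (\<lambda>a C. \<Union>x\<in>C. N +>\<^bsub>M\<^esub> (a \<odot>\<^bsub>M\<^esub> x))\<rparr>"

definition reduced_homology ::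
  "'f ring \<Rightarrow> 'a::linorder set set \<Rightarrow> int \<Rightarrow> ('f, ('a set \<Rightarrow> 'f) set) module" where
  "reduced_homology F X i = quotient_module (cycles F X i) (boundaries F X i)"

definition module_isomorphic :: "'f ring \<Rightarrow> ('f, 'b) module \<Rightarrow> ('f, 'c) module \<Rightarrow> bool" where
  "module_isomorphic F M N \<longleftrightarrow>
     (\<exists>h \<in> iso (add_monoid M) (add_monoid N).
        \<forall>a \<in> carrier F. \<forall>x \<in> carrier M. h (a \<odot>\<^bsub>M\<^esub> x) = a \<odot>\<^bsub>N\<^esub> h x)"

definition self_module :: "'f ring \<Rightarrow> ('f, 'f) module" where
  "self_module F =
     \<lparr>carrier = carrier F, mult = mult F, one = \<one>\<^bsub>F\<^esub>,
      zero = \<zero>\<^bsub>F\<^esub>, add = add F, smult = mult F\<rparr>"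

definition trivial_module :: "('f, 'b) module \<Rightarrow> bool" where
  "trivial_module M \<longleftrightarrow> carrier M = {\<zero>\<^bsub>M\<^esub>}"

definition acyclic_complex :: "'f ring \<Rightarrow> 'a::linorder set set \<Rightarrow> bool" where
  "acyclic_complex F X \<longleftrightarrow> (\<forall>i. trivial_module (reduced_homology F X i))"

definition has_homology_of_sphere :: "'f ring \<Rightarrow> int \<Rightarrow> 'a::linorder set set \<Rightarrow> bool" where
  "has_homology_of_sphere F n X \<longleftrightarrow>
     module_isomorphic F (reduced_homology F X n) (self_module F) \<and>
     (\<forall>i. i \<noteq> n \<longrightarrow> trivial_module (reduced_homology F X i))"


section \<open>Homology spheres and balls\<close>

definition F_homology_sphere :: "'f ring \<Rightarrow> int \<Rightarrow> 'a::linorder set set \<Rightarrow> bool" where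
  "F_homology_sphere F d X \<longleftrightarrow>
     simplicial_complex X \<and> complex_dim X = d \<and>
     (\<forall>\<sigma>\<in>X. has_homology_of_sphere F (d - face_dim \<sigma> - 1) (link \<sigma> X))"

definition ball_boundary :: "'f ring \<Rightarrow> 'a::linorder set set \<Rightarrow> 'a set set" where
  "ball_boundary F B = {\<sigma> \<in> B. acyclic_complex F (link \<sigma> B)}"

text \<open>A point has vanishing reduced homology, so "has the reduced homology of a point"
  is \<^const>\<open>acyclic_complex\<close>.\<close>

definition F_homology_ball :: "'f ring \<Rightarrow> int \<Rightarrow> 'a::linorder set set \<Rightarrow> bool" where
  "F_homology_ball F d B \<longleftrightarrow>
     simplicial_complex B \<and> complex_dim B = d \<and> acyclic_complex F B \<and>
     (\<forall>\<sigma>\<in>B. \<sigma> \<noteq> {} \<longrightarrow>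
        has_homology_of_sphere F (d - face_dim \<sigma> - 1) (link \<sigma> B) \<or>
        acyclic_complex F (link \<sigma> B)) \<and>
     F_homology_sphere F (d - 1) (ball_boundary F B)"

definition F_stacked_ball :: "'f ring \<Rightarrow> int \<Rightarrow> int \<Rightarrow> 'a::linorder set set \<Rightarrow> bool" where
  "F_stacked_ball F k d B \<longleftrightarrow>
     F_homology_ball F d B \<and>
     (\<forall>\<sigma>\<in>B. d - face_dim \<sigma> \<ge> k + 1 \<longrightarrow> \<sigma> \<in> ball_boundary F B)"

text \<open>HOL cannot quantify over all fields in one formula. The type argument is the universe
  from which the elements of the field are taken; its carrier may be any subset of that type.\<close>

definition homology_sphere :: "'f itself \<Rightarrow> int \<Rightarrow> 'a::linorder set set \<Rightarrow> bool" where
  "homology_sphere T d X \<longleftrightarrow> (\<exists>F :: 'f ring. field F \<and> F_homology_sphere F d X)"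

definition stacked_sphere :: "'f itself \<Rightarrow> int \<Rightarrow> int \<Rightarrow> 'a::linorder set set \<Rightarrow> bool" where
  "stacked_sphere T k d X \<longleftrightarrow>
     homology_sphere T d X \<and>
     (\<exists>(F :: 'f ring) B. field F \<and> F_stacked_ball F k (d + 1) B \<and> X = ball_boundary F B)"

end

theory Submission
  imports Defs
begin

text \<open>A bistellar move \<open>\<alpha> \<mapsto> {v}\<close> of index 0 on a sphere amounts to gluing the simplex
  \<open>\<alpha> \<union> {v}\<close> along \<open>\<alpha>\<close> to a ball that it bounds, and gluing along a simplex keeps acyclic links
  acyclic. Conversely, let \<open>B\<close> be a 1-stacked ball, so that only its facets and the ridges lying
  in two facets are interior. Since links of faces of codimension at least 2 are acyclic, hence
  connected, the facets containing a given face are connected in the dual graph. Every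
  interior ridge is a bridge of the dual graph, so this graph is a tree. Building \<open>B\<close> up facet by
  facet along the tree, each new facet brings a new vertex, and the boundary changes by a
  move of index 0.\<close>

section \<open>The simplicial boundary operator\<close>

text \<open>New vertices are the crux of both directions. A move only promises a vertex new to the
  sphere, while gluing needs one new to the ball. For spheres of positive dimension the two agree:
  vertices of a 1-stacked ball then have codimension at least 2, so they lie on the boundary. For
  dimension 0 the ball is a path, whose inner vertices are off the boundary and may come back, so
  two points are treated by themselves. Conversely, let a facet \<open>T\<close> be attached along a
  ridge, and suppose its remaining vertex \<open>v\<close> were old. The connected star of
  \<open>v\<close> and the connected set of old facets would then give a way around the ridge, which
  is impossible for a bridge. Intermediate stages are not shown to be balls. In one direction only
  the shape of links is tracked (acyclic, empty or two points), and the boundary sphere is supplied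
  at the end by the hypothesis on \<open>X\<close>. In the other, the boundary of a set of facets is
  defined by counting facets over ridges, and is compared with the homological one only for the
  whole ball.\<close>

locale coeff_field = field F for F :: "'f ring" (structure)
begin

text \<open>The incidence number of \<open>\<tau>\<close> in \<open>insert v \<tau>\<close> if
  \<open>v\<close> is not in \<open>\<tau>\<close>: the exponent is the position of \<open>v\<close>
  in the larger face.\<close>

definition sg :: "'a::linorder set \<Rightarrow> 'a \<Rightarrow> 'f" where
  "sg \<tau> v = (\<ominus> \<one>) [^] card {u \<in> \<tau>. u < v}"

text \<open>The vertex set is a parameter, so that boundaries in a subcomplex, in the whole complex
  and at a single ridge can be compared by \<open>bd_mono\<close>.\<close>

definition bd :: "'a::linorder set \<Rightarrow> ('a set \<Rightarrow> 'f) \<Rightarrow> 'a set \<Rightarrow> 'f" where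
  "bd U c \<tau> = (\<Oplus>v\<in>U - \<tau>. sg \<tau> v \<otimes> c (insert v \<tau>))"

text \<open>The chain joining the faces of \<open>c\<close> to \<open>w\<close>, with the sign of
  moving \<open>w\<close> from the front to its place in the vertex order. Faces of \<open>c\<close>
  that already contain \<open>w\<close> are dropped.\<close>

definition cone :: "'a::linorder \<Rightarrow> ('a set \<Rightarrow> 'f) \<Rightarrow> 'a set \<Rightarrow> 'f" where
  "cone w c \<tau> = (if w \<in> \<tau> then sg (\<tau> - {w}) w \<otimes> c (\<tau> - {w}) else \<zero>)"

definition supported :: "'a set \<Rightarrow> ('a set \<Rightarrow> 'f) \<Rightarrow> bool" where
  "supported U c \<longleftrightarrow> (\<forall>\<sigma>. c \<sigma> \<in> carrier F \<and> (c \<sigma> \<noteq> \<zero> \<longrightarrow> \<sigma> \<subseteq> U))"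

lemma chain_bd_eq_bd: "chain_bd F X c = bd (\<Union>X) c"
  by (auto simp: chain_bd_def bd_def sg_def)

lemma minus_one_pow_cases: "(\<ominus> \<one>) [^] (k::nat) = \<one> \<or> (\<ominus> \<one>) [^] k = \<ominus> \<one>"
  by (induction k) (auto simp: l_minus r_minus)

lemma sg_cases: "sg \<tau> v = \<one> \<or> sg \<tau> v = \<ominus> \<one>"
  unfolding sg_def by (rule minus_one_pow_cases)

lemma sg_closed [simp, intro]: "sg \<tau> v \<in> carrier F"
  using sg_cases[of \<tau> v] by auto

lemma sg_square [simp]: "sg \<tau> v \<otimes> sg \<tau> v = \<one>"
  using sg_cases[of \<tau> v] by (auto simp: l_minus r_minus)

lemma sg_square_left [simp]: "x \<in> carrier F \<Longrightarrow> sg \<tau> v \<otimes> (sg \<tau> v \<otimes> x) = x"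
  by (simp flip: m_assoc)

lemma sg_empty [simp]: "sg {} v = \<one>"
  by (simp add: sg_def)

lemma sg_insert:
  assumes "finite \<tau>" "w \<notin> \<tau>"
  shows "sg (insert w \<tau>) v = (if w < v then \<ominus> sg \<tau> v else sg \<tau> v)"
proof (cases "w < v")
  case True
  then have "{u \<in> insert w \<tau>. u < v} = insert w {u \<in> \<tau>. u < v}" by auto
  then have "card {u \<in> insert w \<tau>. u < v} = Suc (card {u \<in> \<tau>. u < v})"
    using assms by simp
  then show ?thesis using True by (simp add: sg_def l_minus r_minus)
next
  case False
  then have "{u \<in> insert w \<tau>. u < v} = {u \<in> \<tau>. u < v}" by auto
  then show ?thesis using False by (simp add: sg_def)
qed

text \<open>Inserting \<open>w\<close> reverses the sign at \<open>v\<close> iff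
  \<open>w < v\<close>, and inserting \<open>v\<close> reverses the sign at \<open>w\<close> iff
  \<open>v < w\<close>. Exactly one of the two happens.\<close>

lemma sg_swap:
  assumes "finite \<tau>" "v \<notin> \<tau>" "w \<notin> \<tau>" "v \<noteq> w"
  shows "sg (insert w \<tau>) v \<otimes> sg (insert v \<tau>) w = \<ominus> (sg \<tau> w \<otimes> sg \<tau> v)"
  using assms sg_cases[of \<tau> v] sg_cases[of \<tau> w]
  by (cases "v < w") (auto simp: sg_insert l_minus r_minus)

lemma sg_swap':
  assumes "finite \<tau>" "v \<notin> \<tau>" "w \<notin> \<tau>" "v \<noteq> w"
  shows "sg \<tau> v \<otimes> sg (insert v \<tau>) w = \<ominus> (sg \<tau> w \<otimes> sg (insert w \<tau>) v)"
  using assms sg_cases[of \<tau> v] sg_cases[of \<tau> w]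
  by (cases "v < w") (auto simp: sg_insert l_minus r_minus)

lemma finsum_eq_single:
  assumes "finite A" "w \<in> A" "f w \<in> carrier F" "\<And>v. v \<in> A \<Longrightarrow> v \<noteq> w \<Longrightarrow> f v = \<zero>"
  shows "(\<Oplus>v\<in>A. f v) = f w"
proof -
  have "(\<Oplus>v\<in>A. f v) = (\<Oplus>v\<in>A. if w = v then f v else \<zero>)"
    using assms by (intro add.finprod_cong') auto
  also have "\<dots> = f w"
    using assms by (intro add.finprod_singleton) (auto simp: Pi_def, metis zero_closed)
  finally show ?thesis .
qed

text \<open>The terms at \<open>(i, j)\<close> and \<open>(j, i)\<close> cancel. The vanishing
  diagonal is a separate assumption because antisymmetry does not give it in characteristic
  2.\<close>

lemma finsum_alternating:
  assumes "finite A" "\<And>i j. g i j \<in> carrier F" "\<And>i. g i i = \<zero>" "\<And>i j. g i j = \<ominus> g j i"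
  shows "(\<Oplus>i\<in>A. \<Oplus>j\<in>A. g i j) = \<zero>"
  using assms(1)
proof (induction A rule: finite_induct)
  case empty
  then show ?case by simp
next
  case (insert w A)
  have 1: "(\<Oplus>j\<in>insert w A. g i j) = g i w \<oplus> (\<Oplus>j\<in>A. g i j)" for i
    using insert assms(2) by (simp add: Pi_def)
  have "(\<Oplus>i\<in>insert w A. \<Oplus>j\<in>insert w A. g i j)
      = (\<Oplus>j\<in>A. g w j) \<oplus> (\<Oplus>i\<in>A. g i w \<oplus> (\<Oplus>j\<in>A. g i j))"
    using insert assms(2,3) by (simp add: 1 Pi_def a_comm)
  also have "(\<Oplus>i\<in>A. g i w \<oplus> (\<Oplus>j\<in>A. g i j)) = (\<Oplus>i\<in>A. g i w)"
    using insert assms(2) by (subst finsum_addf) (simp_all add: Pi_def)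
  also have "(\<Oplus>j\<in>A. g w j) \<oplus> (\<Oplus>i\<in>A. g i w) = (\<Oplus>j\<in>A. g w j \<oplus> g j w)"
    using insert assms(2) by (subst finsum_addf) (simp_all add: Pi_def)
  also have "\<dots> = (\<Oplus>j\<in>A. \<zero>)"
  proof (intro add.finprod_cong' refl)
    fix j
    show "g w j \<oplus> g j w = \<zero>" using assms(2) assms(4)[of w j] by (metis l_neg)
  qed simp
  finally show ?case by simp
qed

lemma supported_closed: "supported U c \<Longrightarrow> c \<sigma> \<in> carrier F"
  by (simp add: supported_def)

lemma supported_zero: "supported U c \<Longrightarrow> \<not> \<sigma> \<subseteq> U \<Longrightarrow> c \<sigma> = \<zero>"
  by (auto simp: supported_def)

lemma bd_closed: "(\<And>\<sigma>. c \<sigma> \<in> carrier F) \<Longrightarrow> bd U c \<tau> \<in> carrier F"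
  unfolding bd_def by (intro add.finprod_closed) auto

lemma bd_outside: "supported U c \<Longrightarrow> \<not> \<tau> \<subseteq> U \<Longrightarrow> bd U c \<tau> = \<zero>"
  unfolding bd_def by (intro add.finprod_one_eqI) (auto simp: supported_zero)

lemma supported_bd: "supported U c \<Longrightarrow> supported U (bd U c)"
  using bd_outside bd_closed unfolding supported_def by metis

lemma cone_closed: "(\<And>\<sigma>. c \<sigma> \<in> carrier F) \<Longrightarrow> cone w c \<tau> \<in> carrier F"
  by (simp add: cone_def)

lemma supported_cone: "supported U c \<Longrightarrow> w \<in> U \<Longrightarrow> supported U (cone w c)"
  unfolding supported_def cone_def by (auto; metis r_null sg_closed subset_iff insert_Diff insert_iff)

lemma bd_add:
  assumes "\<And>\<sigma>. c \<sigma> \<in> carrier F" "\<And>\<sigma>. c' \<sigma> \<in> carrier F"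
  shows "bd U (\<lambda>\<sigma>. c \<sigma> \<oplus> c' \<sigma>) \<tau> = bd U c \<tau> \<oplus> bd U c' \<tau>"
  unfolding bd_def using assms by (simp add: r_distr Pi_def finsum_addf)

lemma bd_smult:
  assumes "\<And>\<sigma>. c \<sigma> \<in> carrier F" "a \<in> carrier F" "finite U"
  shows "bd U (\<lambda>\<sigma>. a \<otimes> c \<sigma>) \<tau> = a \<otimes> bd U c \<tau>"
  unfolding bd_def using assms
  by (subst finsum_rdistr) (auto simp: Pi_def m_lcomm intro!: add.finprod_cong')

lemma bd_uminus:
  assumes "\<And>\<sigma>. c \<sigma> \<in> carrier F" "finite U"
  shows "bd U (\<lambda>\<sigma>. \<ominus> c \<sigma>) \<tau> = \<ominus> bd U c \<tau>"
  using bd_smult[of c "\<ominus> \<one>" U \<tau>] assms by (simp add: l_minus bd_closed)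

lemma bd_minus:
  assumes "\<And>\<sigma>. c \<sigma> \<in> carrier F" "\<And>\<sigma>. c' \<sigma> \<in> carrier F" "finite U"
  shows "bd U (\<lambda>\<sigma>. c \<sigma> \<ominus> c' \<sigma>) \<tau> = bd U c \<tau> \<ominus> bd U c' \<tau>"
  using assms by (simp add: a_minus_def bd_add bd_uminus)

lemma bd_bd:
  assumes "finite U" "supported U c"
  shows "bd U (bd U c) \<tau> = \<zero>"
proof (cases "\<tau> \<subseteq> U")
  case False
  then show ?thesis using assms bd_outside supported_bd by blast
next
  case True
  then have fin: "finite \<tau>" using assms finite_subset by blast
  note cl = supported_closed[OF assms(2)]
  \<comment> \<open>Padding with zeros turns the nested index sets into one square, where the two
    orders of adding \<open>u\<close> and \<open>v\<close> cancel by
    \<open>sg_swap'\<close>.\<close>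
  define g where "g v u = (if u = v \<or> v \<in> \<tau> \<or> u \<in> \<tau> then \<zero>
     else sg \<tau> v \<otimes> sg (insert v \<tau>) u \<otimes> c (insert u (insert v \<tau>)))" for v u
  have "bd U (bd U c) \<tau> = (\<Oplus>v\<in>U - \<tau>. \<Oplus>u\<in>U - \<tau>. g v u)"
    unfolding bd_def[of U "bd U c"]
  proof (intro add.finprod_cong' refl)
    fix v assume v: "v \<in> U - \<tau>"
    have "sg \<tau> v \<otimes> bd U c (insert v \<tau>)
       = (\<Oplus>u\<in>U - insert v \<tau>. sg \<tau> v \<otimes> (sg (insert v \<tau>) u \<otimes> c (insert u (insert v \<tau>))))"
      unfolding bd_def using assms cl by (intro finsum_rdistr) auto
    also have "\<dots> = (\<Oplus>u\<in>U - insert v \<tau>. g v u)"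
      using v cl by (intro add.finprod_cong') (auto simp: g_def m_assoc)
    also have "\<dots> = g v v \<oplus> (\<Oplus>u\<in>U - insert v \<tau>. g v u)"
      using cl by (simp add: g_def)
    also have "\<dots> = (\<Oplus>u\<in>insert v (U - insert v \<tau>). g v u)"
      using assms cl by (intro add.finprod_insert[symmetric]) (auto simp: g_def)
    also have "insert v (U - insert v \<tau>) = U - \<tau>" using v by auto
    finally show "sg \<tau> v \<otimes> bd U c (insert v \<tau>) = (\<Oplus>u\<in>U - \<tau>. g v u)" .
  qed (use cl in \<open>auto simp: g_def\<close>)
  also have "\<dots> = \<zero>"
  proof (rule finsum_alternating)
    fix i j
    show "g i j = \<ominus> g j i"
    proof (cases "i = j \<or> i \<in> \<tau> \<or> j \<in> \<tau>")
      case False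
      then show ?thesis
        using cl sg_swap'[OF fin, of i j] by (auto simp: g_def l_minus insert_commute)
    qed (auto simp: g_def)
  qed (use assms cl in \<open>auto simp: g_def\<close>)
  finally show ?thesis .
qed

text \<open>Coning is a chain homotopy from the identity to zero. Every acyclicity proof below rests
  on this identity.\<close>

lemma bd_cone:
  assumes "finite U" "supported U c" "w \<in> U"
  shows "bd U (cone w c) \<tau> \<oplus> cone w (bd U c) \<tau> = c \<tau>"
proof (cases "\<tau> \<subseteq> U")
  case False
  then have "\<not> \<tau> - {w} \<subseteq> U" using assms by auto
  with False show ?thesis
    using bd_outside[OF supported_cone[OF assms(2,3)] False] bd_outside[OF assms(2)]
      supported_zero[OF assms(2) False]
    by (simp add: cone_def)
next
  case True
  note cl = supported_closed[OF assms(2)]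
  show ?thesis
  proof (cases "w \<in> \<tau>")
    case False
    then have *: "insert w \<tau> - {w} = \<tau>" by auto
    have "bd U (cone w c) \<tau> = sg \<tau> w \<otimes> cone w c (insert w \<tau>)"
      unfolding bd_def using assms False cl
      by (intro finsum_eq_single) (auto simp: cone_def)
    also have "\<dots> = c \<tau>" using False cl by (simp add: cone_def *)
    finally show ?thesis using False cl by (simp add: cone_def)
  next
    case w: True
    define \<rho> where "\<rho> = \<tau> - {w}"
    have \<tau>: "\<tau> = insert w \<rho>" "w \<notin> \<rho>" using w by (auto simp: \<rho>_def)
    have fin: "finite \<rho>" using True assms finite_subset unfolding \<rho>_def by blast
    have U: "U - \<rho> = insert w (U - \<tau>)" using w assms(3) by (auto simp: \<rho>_def)
    \<comment> \<open>The summand at \<open>w\<close> is split off: its sign squares to one and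
      leaves \<open>c \<tau>\<close>. The other summands cancel against those of
      \<open>bd U (cone w c) \<tau>\<close>.\<close>
    have 1: "bd U c \<rho> = sg \<rho> w \<otimes> c \<tau> \<oplus> (\<Oplus>v\<in>U - \<tau>. sg \<rho> v \<otimes> c (insert v \<rho>))"
      unfolding bd_def U using assms w cl by (subst add.finprod_insert) (auto simp: \<tau>(1))
    have 2: "cone w (bd U c) \<tau> = sg \<rho> w \<otimes> bd U c \<rho>"
      using w by (simp add: cone_def \<rho>_def)
    also have "\<dots> = c \<tau> \<oplus> sg \<rho> w \<otimes> (\<Oplus>v\<in>U - \<tau>. sg \<rho> v \<otimes> c (insert v \<rho>))"
      unfolding 1 using cl by (simp add: r_distr)
    also have "sg \<rho> w \<otimes> (\<Oplus>v\<in>U - \<tau>. sg \<rho> v \<otimes> c (insert v \<rho>))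
        = (\<Oplus>v\<in>U - \<tau>. sg \<rho> w \<otimes> (sg \<rho> v \<otimes> c (insert v \<rho>)))"
      using assms cl by (intro finsum_rdistr) auto
    finally have 2: "cone w (bd U c) \<tau> = c \<tau> \<oplus> (\<Oplus>v\<in>U - \<tau>. sg \<rho> w \<otimes> (sg \<rho> v \<otimes> c (insert v \<rho>)))" .
    have 3: "bd U (cone w c) \<tau> = (\<Oplus>v\<in>U - \<tau>. \<ominus> (sg \<rho> w \<otimes> (sg \<rho> v \<otimes> c (insert v \<rho>))))"
      unfolding bd_def
    proof (intro add.finprod_cong' refl)
      fix v assume v: "v \<in> U - \<tau>"
      then have *: "insert v \<tau> - {w} = insert v \<rho>" using \<tau> by auto
      have "sg \<tau> v \<otimes> cone w c (insert v \<tau>) = sg \<tau> v \<otimes> sg (insert v \<rho>) w \<otimes> c (insert v \<rho>)"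
        using w cl by (simp add: cone_def * m_assoc)
      also have "sg \<tau> v \<otimes> sg (insert v \<rho>) w = \<ominus> (sg \<rho> w \<otimes> sg \<rho> v)"
        unfolding \<tau>(1) using v \<tau> fin by (intro sg_swap) auto
      finally show "sg \<tau> v \<otimes> cone w c (insert v \<tau>) = \<ominus> (sg \<rho> w \<otimes> (sg \<rho> v \<otimes> c (insert v \<rho>)))"
        using cl by (simp add: l_minus m_assoc)
    qed (use cl in auto)
    have 4: "bd U (cone w c) \<tau> \<oplus> (\<Oplus>v\<in>U - \<tau>. sg \<rho> w \<otimes> (sg \<rho> v \<otimes> c (insert v \<rho>))) = \<zero>"
      unfolding 3 using cl by (subst finsum_addf[symmetric]) (auto simp: l_neg intro!: add.finprod_one_eqI)
    have "(\<Oplus>v\<in>U - \<tau>. sg \<rho> w \<otimes> (sg \<rho> v \<otimes> c (insert v \<rho>))) \<in> carrier F"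
      using cl by (intro add.finprod_closed) auto
    moreover have "bd U (cone w c) \<tau> \<in> carrier F"
      using cl by (intro bd_closed cone_closed)
    ultimately show ?thesis
      unfolding 2 using 4 cl by (simp add: a_lcomm[of _ "c \<tau>"])
  qed
qed

text \<open>The condition concerns one \<open>\<tau>\<close> only, so that the lemma covers both a
  subcomplex and a ridge with just two vertices above it.\<close>

lemma bd_mono:
  fixes c :: "'a::linorder set \<Rightarrow> 'f"
  assumes "\<And>\<sigma>. c \<sigma> \<in> carrier F" "\<And>v. c (insert v \<tau>) \<noteq> \<zero> \<Longrightarrow> v \<in> \<tau> \<or> v \<in> U" "U \<subseteq> W" "finite W"
  shows "bd W c \<tau> = bd U c \<tau>"
proof -
  have z: "sg \<tau> v \<otimes> c (insert v \<tau>) = \<zero>" if "v \<in> (W - \<tau>) - (U - \<tau>)" for v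
  proof -
    have "c (insert v \<tau>) = \<zero>" using that assms(2)[of v] by blast
    then show ?thesis by simp
  qed
  show ?thesis
    unfolding bd_def
  proof (rule add.finprod_mono_neutral_cong_right)
    show "(\<lambda>v. sg \<tau> v \<otimes> c (insert v \<tau>)) \<in> W - \<tau> \<rightarrow> carrier F" using assms(1) by simp
  qed (use assms(3,4) z in blast)+
qed

end

section \<open>Reduced homology by cycles and boundaries\<close>

lemma finite_vertices: "simplicial_complex X \<Longrightarrow> finite (\<Union>X)"
  by (auto simp: simplicial_complex_def)

lemma face_subset: "simplicial_complex X \<Longrightarrow> \<sigma> \<in> X \<Longrightarrow> \<tau> \<subseteq> \<sigma> \<Longrightarrow> \<tau> \<in> X"
  unfolding simplicial_complex_def by blast

lemma finite_face: "simplicial_complex X \<Longrightarrow> \<sigma> \<in> X \<Longrightarrow> finite \<sigma>"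
  unfolding simplicial_complex_def by blast

context coeff_field
begin

definition is_chain :: "'a set set \<Rightarrow> int \<Rightarrow> ('a set \<Rightarrow> 'f) \<Rightarrow> bool" where
  "is_chain X i c \<longleftrightarrow> (\<forall>\<sigma>. c \<sigma> \<in> carrier F \<and> (c \<sigma> \<noteq> \<zero> \<longrightarrow> \<sigma> \<in> X \<and> face_dim \<sigma> = i))"

definition is_cycle :: "'a::linorder set set \<Rightarrow> int \<Rightarrow> ('a set \<Rightarrow> 'f) \<Rightarrow> bool" where
  "is_cycle X i c \<longleftrightarrow> is_chain X i c \<and> (\<forall>\<tau>. bd (\<Union>X) c \<tau> = \<zero>)"

definition is_bdry :: "'a::linorder set set \<Rightarrow> int \<Rightarrow> ('a set \<Rightarrow> 'f) \<Rightarrow> bool" where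
  "is_bdry X i c \<longleftrightarrow> (\<exists>e. is_chain X (i + 1) e \<and> c = bd (\<Union>X) e)"

lemma carrier_chains: "carrier (chains F X i) = {c. is_chain X i c}"
  unfolding chains_def is_chain_def by (auto; metis zero_closed)

lemma carrier_cycles: "carrier (cycles F X i) = {c. is_cycle X i c}"
proof -
  have "zero (chains F X (i - 1)) = (\<lambda>\<sigma>. \<zero>)" by (simp add: chains_def)
  then show ?thesis
    by (simp add: cycles_def carrier_chains is_cycle_def chain_bd_eq_bd fun_eq_iff)
qed

lemma boundaries_eq: "boundaries F X i = {c. is_bdry X i c}"
  by (auto simp: boundaries_def carrier_chains is_bdry_def chain_bd_eq_bd)

lemma cycles_simps [simp]:
  "add (cycles F X i) c c' = (\<lambda>\<sigma>. c \<sigma> \<oplus> c' \<sigma>)"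
  "zero (cycles F X i) = (\<lambda>\<sigma>. \<zero>)"
  "smult (cycles F X i) a c = (\<lambda>\<sigma>. a \<otimes> c \<sigma>)"
  by (simp_all add: cycles_def chains_def)

lemma is_chain_closed: "is_chain X i c \<Longrightarrow> c \<sigma> \<in> carrier F"
  by (simp add: is_chain_def)

lemma is_chain_zero: "is_chain X i c \<Longrightarrow> \<sigma> \<notin> X \<or> face_dim \<sigma> \<noteq> i \<Longrightarrow> c \<sigma> = \<zero>"
  by (auto simp: is_chain_def)

lemma is_cycle_closed: "is_cycle X i c \<Longrightarrow> c \<sigma> \<in> carrier F"
  by (simp add: is_cycle_def is_chain_def)

lemma is_chain_supported: "is_chain X i c \<Longrightarrow> supported (\<Union>X) c"
  by (auto simp: is_chain_def supported_def)

lemma is_chain_0 [simp]: "is_chain X i (\<lambda>\<sigma>. \<zero>)"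
  by (simp add: is_chain_def)

lemma bd_0 [simp]: "bd U (\<lambda>\<sigma>. \<zero>) \<tau> = \<zero>"
  unfolding bd_def by (simp add: add.finprod_one_eqI)

lemma is_chain_bd:
  assumes "simplicial_complex X" "is_chain X i c"
  shows "is_chain X (i - 1) (bd (\<Union>X) c)"
  unfolding is_chain_def
proof (intro allI conjI impI)
  note cl = is_chain_closed[OF assms(2)]
  show "bd (\<Union>X) c \<tau> \<in> carrier F" for \<tau> using cl by (rule bd_closed)
  fix \<tau> assume *: "bd (\<Union>X) c \<tau> \<noteq> \<zero>"
  have "\<exists>v\<in>\<Union>X - \<tau>. c (insert v \<tau>) \<noteq> \<zero>"
  proof (rule ccontr)
    assume "\<not> ?thesis"
    then have "bd (\<Union>X) c \<tau> = \<zero>"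
      unfolding bd_def by (intro add.finprod_one_eqI) auto
    with * show False by simp
  qed
  then obtain v where v: "v \<notin> \<tau>" "c (insert v \<tau>) \<noteq> \<zero>" by blast
  then have X: "insert v \<tau> \<in> X" "face_dim (insert v \<tau>) = i"
    using assms(2) by (auto simp: is_chain_def)
  then have "finite \<tau>" using finite_face[OF assms(1) X(1)] by simp
  then show "face_dim \<tau> = i - 1" using X v by (simp add: face_dim_def)
  show "\<tau> \<in> X" using face_subset[OF assms(1) X(1)] by blast
qed

lemma is_chain_add:
  assumes "is_chain X i c" "is_chain X i c'"
  shows "is_chain X i (\<lambda>\<sigma>. c \<sigma> \<oplus> c' \<sigma>)"
  unfolding is_chain_def
proof (intro allI conjI)
  fix \<sigma>
  show "c \<sigma> \<oplus> c' \<sigma> \<in> carrier F" using assms by (simp add: is_chain_def)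
  show "c \<sigma> \<oplus> c' \<sigma> \<noteq> \<zero> \<longrightarrow> \<sigma> \<in> X \<and> face_dim \<sigma> = i"
  proof (rule impI, rule ccontr)
    assume "c \<sigma> \<oplus> c' \<sigma> \<noteq> \<zero>" and "\<not> (\<sigma> \<in> X \<and> face_dim \<sigma> = i)"
    moreover from this have "c \<sigma> = \<zero>" "c' \<sigma> = \<zero>" using assms is_chain_zero by blast+
    ultimately show False by simp
  qed
qed

lemma is_chain_smult:
  assumes "is_chain X i c" "a \<in> carrier F"
  shows "is_chain X i (\<lambda>\<sigma>. a \<otimes> c \<sigma>)"
  unfolding is_chain_def
proof (intro allI conjI)
  fix \<sigma>
  show "a \<otimes> c \<sigma> \<in> carrier F" using assms by (simp add: is_chain_def)
  show "a \<otimes> c \<sigma> \<noteq> \<zero> \<longrightarrow> \<sigma> \<in> X \<and> face_dim \<sigma> = i"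
    using assms by (metis is_chain_def r_null)
qed

lemma is_chain_uminus: "is_chain X i c \<Longrightarrow> is_chain X i (\<lambda>\<sigma>. \<ominus> c \<sigma>)"
  by (simp add: is_chain_def)

lemma is_chain_minus:
  "is_chain X i c \<Longrightarrow> is_chain X i c' \<Longrightarrow> is_chain X i (\<lambda>\<sigma>. c \<sigma> \<ominus> c' \<sigma>)"
  unfolding a_minus_def by (intro is_chain_add is_chain_uminus)

lemma is_cycle_0 [simp]: "is_cycle X i (\<lambda>\<sigma>. \<zero>)"
  by (simp add: is_cycle_def)

lemma is_cycle_add:
  "is_cycle X i c \<Longrightarrow> is_cycle X i c' \<Longrightarrow> is_cycle X i (\<lambda>\<sigma>. c \<sigma> \<oplus> c' \<sigma>)"
  using is_chain_closed[of X i c] is_chain_closed[of X i c']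
  unfolding is_cycle_def by (simp add: is_chain_add bd_add)

lemma is_cycle_smult:
  "simplicial_complex X \<Longrightarrow> is_cycle X i c \<Longrightarrow> a \<in> carrier F \<Longrightarrow> is_cycle X i (\<lambda>\<sigma>. a \<otimes> c \<sigma>)"
  using is_chain_closed[of X i c]
  unfolding is_cycle_def by (simp add: is_chain_smult bd_smult finite_vertices)

lemma is_cycle_uminus:
  "simplicial_complex X \<Longrightarrow> is_cycle X i c \<Longrightarrow> is_cycle X i (\<lambda>\<sigma>. \<ominus> c \<sigma>)"
  using is_chain_closed[of X i c]
  unfolding is_cycle_def by (simp add: is_chain_uminus bd_uminus finite_vertices)

lemma is_bdry_0 [simp]: "is_bdry X i (\<lambda>\<sigma>. \<zero>)"
  unfolding is_bdry_def by (rule exI[of _ "\<lambda>\<sigma>. \<zero>"]) auto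

lemma is_bdry_add:
  assumes "is_bdry X i c" "is_bdry X i c'"
  shows "is_bdry X i (\<lambda>\<sigma>. c \<sigma> \<oplus> c' \<sigma>)"
proof -
  obtain e e' where e: "is_chain X (i + 1) e" "c = bd (\<Union>X) e"
    "is_chain X (i + 1) e'" "c' = bd (\<Union>X) e'"
    using assms unfolding is_bdry_def by blast
  moreover from this have "(\<lambda>\<sigma>. c \<sigma> \<oplus> c' \<sigma>) = bd (\<Union>X) (\<lambda>\<sigma>. e \<sigma> \<oplus> e' \<sigma>)"
    using is_chain_closed[OF e(1)] is_chain_closed[OF e(3)] by (intro ext) (simp add: bd_add)
  ultimately show ?thesis unfolding is_bdry_def using is_chain_add by blast
qed

lemma is_bdry_smult:
  assumes "simplicial_complex X" "is_bdry X i c" "a \<in> carrier F"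
  shows "is_bdry X i (\<lambda>\<sigma>. a \<otimes> c \<sigma>)"
proof -
  obtain e where e: "is_chain X (i + 1) e" "c = bd (\<Union>X) e"
    using assms unfolding is_bdry_def by blast
  moreover from this have "(\<lambda>\<sigma>. a \<otimes> c \<sigma>) = bd (\<Union>X) (\<lambda>\<sigma>. a \<otimes> e \<sigma>)"
    using bd_smult[OF is_chain_closed[OF e(1)] assms(3) finite_vertices[OF assms(1)]]
    by (intro ext) simp
  ultimately show ?thesis unfolding is_bdry_def using is_chain_smult assms(3) by blast
qed

lemma is_bdry_uminus:
  assumes "simplicial_complex X" "is_bdry X i c"
  shows "is_bdry X i (\<lambda>\<sigma>. \<ominus> c \<sigma>)"
proof -
  have "c \<sigma> \<in> carrier F" for \<sigma>
    using assms(2) unfolding is_bdry_def by (auto intro: bd_closed is_chain_closed)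
  then show ?thesis using is_bdry_smult[OF assms, of "\<ominus> \<one>"] by (simp add: l_minus)
qed

lemma is_bdry_is_cycle:
  assumes "simplicial_complex X" "is_bdry X i c"
  shows "is_cycle X i c"
proof -
  obtain e where e: "is_chain X (i + 1) e" "c = bd (\<Union>X) e"
    using assms unfolding is_bdry_def by blast
  then have "bd (\<Union>X) c \<tau> = \<zero>" for \<tau>
    using bd_bd finite_vertices[OF assms(1)] is_chain_supported by blast
  then show ?thesis using is_chain_bd[OF assms(1) e(1)] e(2) by (simp add: is_cycle_def)
qed

lemma abelian_group_cycles:
  assumes "simplicial_complex X"
  shows "abelian_group (cycles F X i)"
proof (rule abelian_groupI)
  fix c assume "c \<in> carrier (cycles F X i)"
  then show "\<exists>y\<in>carrier (cycles F X i). y \<oplus>\<^bsub>cycles F X i\<^esub> c = \<zero>\<^bsub>cycles F X i\<^esub>"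
    by (intro bexI[of _ "\<lambda>\<sigma>. \<ominus> c \<sigma>"])
      (auto simp: carrier_cycles is_cycle_uminus[OF assms] is_cycle_closed l_neg)
qed (auto simp: carrier_cycles is_cycle_add is_cycle_closed a_ac)

lemma cycles_a_inv:
  assumes "simplicial_complex X" "is_cycle X i c"
  shows "\<ominus>\<^bsub>cycles F X i\<^esub> c = (\<lambda>\<sigma>. \<ominus> c \<sigma>)"
  using abelian_group_cycles[OF assms(1)]
  by (rule abelian_group.minus_equality)
    (use assms in \<open>auto simp: carrier_cycles is_cycle_uminus is_cycle_closed l_neg\<close>)

lemma subgroup_boundaries:
  assumes "simplicial_complex X"
  shows "subgroup (boundaries F X i) (add_monoid (cycles F X i))"
proof (rule subgroup.intro)
  fix c assume "c \<in> boundaries F X i"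
  then have "is_bdry X i c" by (simp add: boundaries_eq)
  then show "inv\<^bsub>add_monoid (cycles F X i)\<^esub> c \<in> boundaries F X i"
    using is_bdry_uminus[OF assms] cycles_a_inv[OF assms is_bdry_is_cycle[OF assms]]
    by (simp add: boundaries_eq a_inv_def)
qed (use assms in \<open>auto simp: boundaries_eq carrier_cycles is_bdry_is_cycle is_bdry_add\<close>)

lemma mem_coset_iff:
  "y \<in> boundaries F X i +>\<^bsub>cycles F X i\<^esub> x \<longleftrightarrow> (\<exists>b. is_bdry X i b \<and> y = (\<lambda>\<sigma>. b \<sigma> \<oplus> x \<sigma>))"
  by (auto simp: a_r_coset_def' boundaries_eq)

lemma carrier_reduced_homology:
  "carrier (reduced_homology F X i) = (\<lambda>c. boundaries F X i +>\<^bsub>cycles F X i\<^esub> c) ` {c. is_cycle X i c}"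
  by (auto simp: reduced_homology_def quotient_module_def A_RCOSETS_def' carrier_cycles)

lemma cycle_mem_coset: "is_cycle X i c \<Longrightarrow> c \<in> boundaries F X i +>\<^bsub>cycles F X i\<^esub> c"
  unfolding mem_coset_iff
  by (rule exI[of _ "\<lambda>\<sigma>. \<zero>"]) (auto simp: is_cycle_closed)

lemma coset_eq_boundaries_iff:
  assumes "simplicial_complex X" "is_cycle X i c"
  shows "boundaries F X i +>\<^bsub>cycles F X i\<^esub> c = boundaries F X i \<longleftrightarrow> is_bdry X i c"
proof
  assume "boundaries F X i +>\<^bsub>cycles F X i\<^esub> c = boundaries F X i"
  then show "is_bdry X i c" using cycle_mem_coset[OF assms(2)] by (simp add: boundaries_eq)
next
  assume "is_bdry X i c"
  then show "boundaries F X i +>\<^bsub>cycles F X i\<^esub> c = boundaries F X i"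
    using group.coset_join2[OF abelian_group.a_group[OF abelian_group_cycles[OF assms(1)]] _
        subgroup_boundaries[OF assms(1)]] assms(2)
    by (simp add: a_r_coset_def boundaries_eq carrier_cycles)
qed

lemma trivial_homology_iff:
  assumes "simplicial_complex X"
  shows "trivial_module (reduced_homology F X i) \<longleftrightarrow> (\<forall>c. is_cycle X i c \<longrightarrow> is_bdry X i c)"
proof -
  have "zero (reduced_homology F X i) = boundaries F X i"
    by (simp add: reduced_homology_def quotient_module_def)
  then have "trivial_module (reduced_homology F X i) \<longleftrightarrow>
      (\<lambda>c. boundaries F X i +>\<^bsub>cycles F X i\<^esub> c) ` {c. is_cycle X i c} = {boundaries F X i}"
    by (simp add: trivial_module_def carrier_reduced_homology)
  also have "\<dots> \<longleftrightarrow> (\<forall>c. is_cycle X i c \<longrightarrow> boundaries F X i +>\<^bsub>cycles F X i\<^esub> c = boundaries F X i)"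
    using is_cycle_0[of X i] by blast
  finally show ?thesis using coset_eq_boundaries_iff[OF assms] by blast
qed

lemma acyclic_iff:
  assumes "simplicial_complex X"
  shows "acyclic_complex F X \<longleftrightarrow> (\<forall>i c. is_cycle X i c \<longrightarrow> is_bdry X i c)"
  using trivial_homology_iff[OF assms] by (auto simp: acyclic_complex_def)

section \<open>Homology isomorphic to the field, in terms of cycles\<close>

lemma iso_reduced_homology:
  "iso (add_monoid (reduced_homology F X i)) G = iso (add_monoid (cycles F X i) Mod boundaries F X i) G"
  by (simp add: iso_def hom_def reduced_homology_def quotient_module_def FactGroup_def
      A_RCOSETS_def set_add_def)

lemma smult_reduced_homology:
  "smult (reduced_homology F X i) a C = (\<Union>x\<in>C. boundaries F X i +>\<^bsub>cycles F X i\<^esub> (\<lambda>\<sigma>. a \<otimes> x \<sigma>))"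
  by (simp add: reduced_homology_def quotient_module_def)

lemma self_module_simps [simp]:
  "carrier (self_module F) = carrier F" "add (self_module F) = add F"
  "zero (self_module F) = \<zero>" "smult (self_module F) = mult F"
  by (simp_all add: self_module_def)

lemma abelian_group_self_module: "abelian_group (self_module F)"
  by (rule abelian_groupI) (auto simp: a_ac intro: l_neg)

text \<open>\<open>z\<close> represents the class that the isomorphism \<open>h\<close> sends to
  one. The coefficient of a cycle \<open>c\<close> is then the value of \<open>h\<close> at its
  class, because \<open>h\<close> is linear and injective.\<close>

lemma homology_generator:
  assumes X: "simplicial_complex X"
    and iso: "module_isomorphic F (reduced_homology F X i) (self_module F)"
  obtains z where "is_cycle X i z" "\<not> is_bdry X i z"
    "\<And>c. is_cycle X i c \<Longrightarrow> \<exists>a\<in>carrier F. \<exists>b. is_bdry X i b \<and> c = (\<lambda>\<sigma>. b \<sigma> \<oplus> a \<otimes> z \<sigma>)"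
proof -
  let ?H = "reduced_homology F X i" and ?N = "boundaries F X i"
  let ?co = "\<lambda>c. ?N +>\<^bsub>cycles F X i\<^esub> c"
  obtain h where h: "h \<in> iso (add_monoid ?H) (add_monoid (self_module F))"
    and hs: "\<And>a x. a \<in> carrier F \<Longrightarrow> x \<in> carrier ?H \<Longrightarrow> h (a \<odot>\<^bsub>?H\<^esub> x) = a \<otimes> h x"
    using iso unfolding module_isomorphic_def by auto
  have bij: "bij_betw h (carrier ?H) (carrier F)" using h by (simp add: iso_def)
  then obtain C where C: "C \<in> carrier ?H" "h C = \<one>"
    by (metis bij_betw_def imageE one_closed)
  then obtain z where z: "is_cycle X i z" "C = ?co z" by (auto simp: carrier_reduced_homology)
  \<comment> \<open>Scalar multiplication of a coset is defined as a union of cosets; here that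
    union turns out to be a single coset.\<close>
  have smult_coset: "a \<odot>\<^bsub>?H\<^esub> ?co z = ?co (\<lambda>\<sigma>. a \<otimes> z \<sigma>)" if a: "a \<in> carrier F" for a
  proof (intro equalityI subsetI)
    fix y assume "y \<in> a \<odot>\<^bsub>?H\<^esub> ?co z"
    then obtain b b' where b: "is_bdry X i b" "is_bdry X i b'"
      "y = (\<lambda>\<sigma>. b \<sigma> \<oplus> a \<otimes> (b' \<sigma> \<oplus> z \<sigma>))"
      by (auto simp: smult_reduced_homology mem_coset_iff)
    have cl: "b \<sigma> \<in> carrier F" "b' \<sigma> \<in> carrier F" "z \<sigma> \<in> carrier F" for \<sigma>
      using b is_bdry_is_cycle[OF X] is_cycle_closed z by blast+
    have "y = (\<lambda>\<sigma>. (b \<sigma> \<oplus> a \<otimes> b' \<sigma>) \<oplus> a \<otimes> z \<sigma>)"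
      using cl a by (simp add: b(3) r_distr a_assoc)
    moreover have "is_bdry X i (\<lambda>\<sigma>. b \<sigma> \<oplus> a \<otimes> b' \<sigma>)"
      using b a X by (intro is_bdry_add is_bdry_smult)
    ultimately show "y \<in> ?co (\<lambda>\<sigma>. a \<otimes> z \<sigma>)" unfolding mem_coset_iff by blast
  next
    fix y assume "y \<in> ?co (\<lambda>\<sigma>. a \<otimes> z \<sigma>)"
    then show "y \<in> a \<odot>\<^bsub>?H\<^esub> ?co z"
      using cycle_mem_coset[OF z(1)] by (auto simp: smult_reduced_homology)
  qed
  show ?thesis
  proof
    show "is_cycle X i z" by (rule z)
    show "\<not> is_bdry X i z"
    proof
      assume "is_bdry X i z"
      then have CN: "C = ?N" using coset_eq_boundaries_iff[OF X z(1)] z(2) by simp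
      \<comment> \<open>If \<open>z\<close> were a boundary, its class would equal its own multiple
        by zero, and \<open>h\<close> would send it to zero instead of one.\<close>
      have "is_bdry X i (\<lambda>\<sigma>. \<zero> \<otimes> z \<sigma>)" using \<open>is_bdry X i z\<close> X by (intro is_bdry_smult) auto
      then have "\<zero> \<odot>\<^bsub>?H\<^esub> C = ?N"
        using smult_coset[of \<zero>] z coset_eq_boundaries_iff[OF X] is_bdry_is_cycle[OF X] by simp
      then have "h C = \<zero>" using hs[of \<zero> C] C CN bij by auto
      then show False using C by simp
    qed
    fix c assume c: "is_cycle X i c"
    then have cH: "?co c \<in> carrier ?H" by (simp add: carrier_reduced_homology)
    define a where "a = h (?co c)"
    have a: "a \<in> carrier F" using cH bij unfolding a_def bij_betw_def by blast
    then have "is_cycle X i (\<lambda>\<sigma>. a \<otimes> z \<sigma>)" using X z(1) by (intro is_cycle_smult)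
    then have "?co (\<lambda>\<sigma>. a \<otimes> z \<sigma>) \<in> carrier ?H" by (simp add: carrier_reduced_homology)
    moreover have "h (?co (\<lambda>\<sigma>. a \<otimes> z \<sigma>)) = a"
      using hs[OF a C(1)] C(2) a z(2) smult_coset[OF a] by simp
    ultimately have "?co c = ?co (\<lambda>\<sigma>. a \<otimes> z \<sigma>)"
      using bij cH unfolding bij_betw_def a_def by (metis inj_onD)
    then have "c \<in> ?co (\<lambda>\<sigma>. a \<otimes> z \<sigma>)" using cycle_mem_coset[OF c] by simp
    then show "\<exists>a\<in>carrier F. \<exists>b. is_bdry X i b \<and> c = (\<lambda>\<sigma>. b \<sigma> \<oplus> a \<otimes> z \<sigma>)"
      using a unfolding mem_coset_iff by blast
  qed
qed

text \<open>The first isomorphism theorem for a surjective linear functional \<open>f\<close> on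
  cycles whose kernel is the set of boundaries.\<close>

lemma homology_iso_fieldI:
  assumes X: "simplicial_complex X"
    and closed: "\<And>c. is_cycle X i c \<Longrightarrow> f c \<in> carrier F"
    and add: "\<And>c c'. is_cycle X i c \<Longrightarrow> is_cycle X i c' \<Longrightarrow> f (\<lambda>\<sigma>. c \<sigma> \<oplus> c' \<sigma>) = f c \<oplus> f c'"
    and smult: "\<And>a c. a \<in> carrier F \<Longrightarrow> is_cycle X i c \<Longrightarrow> f (\<lambda>\<sigma>. a \<otimes> c \<sigma>) = a \<otimes> f c"
    and surj: "\<And>a. a \<in> carrier F \<Longrightarrow> \<exists>c. is_cycle X i c \<and> f c = a"
    and ker: "\<And>c. is_cycle X i c \<Longrightarrow> f c = \<zero> \<longleftrightarrow> is_bdry X i c"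
  shows "module_isomorphic F (reduced_homology F X i) (self_module F)"
proof -
  let ?H = "reduced_homology F X i" and ?N = "boundaries F X i"
  let ?G = "add_monoid (cycles F X i)" and ?A = "add_monoid (self_module F)"
  interpret f: group_hom ?G ?A f
  proof (intro group_hom.intro group_hom_axioms.intro)
    show "group ?G" using X by (intro abelian_group.a_group abelian_group_cycles)
    show "group ?A" by (intro abelian_group.a_group abelian_group_self_module)
    show "f \<in> hom ?G ?A" using closed add by (auto simp: hom_def carrier_cycles)
  qed
  have "kernel ?G ?A f = ?N"
    using ker is_bdry_is_cycle[OF X] by (auto simp: kernel_def carrier_cycles boundaries_eq)
  moreover have "f ` carrier ?G = carrier ?A"
    using closed surj by (fastforce simp: carrier_cycles image_iff)
  \<comment> \<open>The theorem for groups supplies the additive isomorphism; compatibility with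
    scalars is checked below on representatives.\<close>
  ultimately have iso: "(\<lambda>C. the_elem (f ` C)) \<in> iso (add_monoid ?H) ?A"
    using f.FactGroup_iso_set by (simp add: iso_reduced_homology)
  have bdry: "is_cycle X i b \<and> f b = \<zero>" if "is_bdry X i b" for b
    using that ker is_bdry_is_cycle[OF X] by blast
  have "the_elem (f ` (a \<odot>\<^bsub>?H\<^esub> C)) = a \<otimes> the_elem (f ` C)"
    if a: "a \<in> carrier F" and C: "C \<in> carrier ?H" for a C
  proof -
    obtain x where x: "is_cycle X i x" "C = ?N +>\<^bsub>cycles F X i\<^esub> x"
      using C by (auto simp: carrier_reduced_homology)
    have fC: "is_cycle X i y \<and> f y = f x" if y: "y \<in> C" for y
    proof -
      obtain b where "is_bdry X i b" "y = (\<lambda>\<sigma>. b \<sigma> \<oplus> x \<sigma>)"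
        using y[unfolded x(2) mem_coset_iff] by blast
      then show ?thesis
        using bdry[of b] x(1) add[of b x] closed[OF x(1)] is_cycle_add[of X i b x] by simp
    qed
    have 1: "the_elem (f ` C) = f x"
    proof (rule the_elem_image_unique)
      show "C \<noteq> {}" using cycle_mem_coset[OF x(1)] x(2) by blast
    qed (use fC in blast)
    have "the_elem (f ` (a \<odot>\<^bsub>?H\<^esub> C)) = f (\<lambda>\<sigma>. a \<otimes> x \<sigma>)"
    proof (rule the_elem_image_unique)
      have "(\<lambda>\<sigma>. a \<otimes> x \<sigma>) \<in> a \<odot>\<^bsub>?H\<^esub> C"
        using cycle_mem_coset[OF x(1)] cycle_mem_coset[OF is_cycle_smult[OF X x(1) a]] x(2)
        by (auto simp: smult_reduced_homology)
      then show "a \<odot>\<^bsub>?H\<^esub> C \<noteq> {}" by blast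
      fix y assume "y \<in> a \<odot>\<^bsub>?H\<^esub> C"
      then obtain b u where b: "is_bdry X i b" "u \<in> C" "y = (\<lambda>\<sigma>. b \<sigma> \<oplus> a \<otimes> u \<sigma>)"
        by (auto simp: smult_reduced_homology mem_coset_iff)
      then have "f y = f b \<oplus> f (\<lambda>\<sigma>. a \<otimes> u \<sigma>)"
        using bdry[OF b(1)] fC[OF b(2)] is_cycle_smult[OF X _ a, of i u]
          add[of b "\<lambda>\<sigma>. a \<otimes> u \<sigma>"] by simp
      also have "\<dots> = a \<otimes> f x"
        using bdry[OF b(1)] fC[OF b(2)] smult[OF a, of u] a closed[OF x(1)] by simp
      finally show "f y = f (\<lambda>\<sigma>. a \<otimes> x \<sigma>)"
        using smult[OF a x(1)] by simp
    qed
    then show ?thesis using 1 smult[OF a x(1)] by simp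
  qed
  then show ?thesis
    unfolding module_isomorphic_def by (intro bexI[OF _ iso]) simp
qed

end

section \<open>Acyclic complexes and complexes of dimension zero\<close>

lemma simplicial_complex_link:
  assumes "simplicial_complex X" "\<sigma> \<in> X"
  shows "simplicial_complex (link \<sigma> X)"
proof -
  have "\<rho> \<in> link \<sigma> X" if "\<tau> \<in> link \<sigma> X" "\<rho> \<subseteq> \<tau>" for \<tau> \<rho>
    using that face_subset[OF assms(1), of \<tau> \<rho>] face_subset[OF assms(1), of "\<tau> \<union> \<sigma>" "\<rho> \<union> \<sigma>"]
    unfolding link_def by blast
  moreover have "finite (link \<sigma> X)" using assms by (simp add: link_def simplicial_complex_def)
  moreover have "{} \<in> link \<sigma> X" using assms by (simp add: link_def simplicial_complex_def)
  moreover have "finite \<tau>" if "\<tau> \<in> link \<sigma> X" for \<tau>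
    using that finite_face[OF assms(1)] by (simp add: link_def)
  ultimately show ?thesis unfolding simplicial_complex_def by blast
qed

lemma simplicial_complex_simplex: "finite A \<Longrightarrow> simplicial_complex (simplex A)"
  by (auto simp: simplicial_complex_def simplex_def intro: finite_subset)

lemma simplicial_complex_dim0:
  assumes "simplicial_complex L" "\<And>\<sigma>. \<sigma> \<in> L \<Longrightarrow> card \<sigma> \<le> 1" "\<sigma> \<in> L"
  shows "\<sigma> = {} \<or> (\<exists>x. \<sigma> = {x})"
proof -
  have "finite \<sigma>" using assms finite_face by blast
  moreover have "card \<sigma> = 0 \<or> card \<sigma> = 1" using assms(2,3) le_Suc_eq by fastforce
  ultimately show ?thesis by (auto simp: card_1_singleton_iff)
qed

context coeff_field
begin

definition delta :: "'a set \<Rightarrow> 'a set \<Rightarrow> 'f" where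
  "delta \<tau> = (\<lambda>\<sigma>. if \<sigma> = \<tau> then \<one> else \<zero>)"

lemma delta_closed [simp]: "delta \<tau> \<sigma> \<in> carrier F"
  by (simp add: delta_def)

lemma is_chain_delta: "\<tau> \<in> X \<Longrightarrow> is_chain X (face_dim \<tau>) (delta \<tau>)"
  by (simp add: is_chain_def delta_def)

lemma is_chain_mono: "is_chain L i c \<Longrightarrow> L \<subseteq> Y \<Longrightarrow> is_chain Y i c"
  unfolding is_chain_def by blast

lemma bd_subcomplex:
  assumes "simplicial_complex Y" "L \<subseteq> Y" "is_chain L i c"
  shows "bd (\<Union>Y) c \<tau> = bd (\<Union>L) c \<tau>"
proof (rule bd_mono)
  fix v assume "c (insert v \<tau>) \<noteq> \<zero>"
  then have "insert v \<tau> \<in> L" using assms(3) by (auto simp: is_chain_def)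
  then show "v \<in> \<tau> \<or> v \<in> \<Union>L" by blast
qed (use assms is_chain_closed finite_vertices in blast)+

lemma is_chain_cone:
  assumes "simplicial_complex Y" "is_chain Y i c" "\<And>\<sigma>. c \<sigma> \<noteq> \<zero> \<Longrightarrow> insert w \<sigma> \<in> Y"
  shows "is_chain Y (i + 1) (cone w c)"
  unfolding is_chain_def
proof (intro allI conjI impI)
  show "cone w c \<tau> \<in> carrier F" for \<tau>
    using is_chain_closed[OF assms(2)] by (rule cone_closed)
  fix \<tau> assume *: "cone w c \<tau> \<noteq> \<zero>"
  then have w: "w \<in> \<tau>" by (metis cone_def)
  moreover have c: "c (\<tau> - {w}) \<noteq> \<zero>" using * w by (auto simp: cone_def)
  ultimately show \<tau>: "\<tau> \<in> Y" using assms(3)[of "\<tau> - {w}"] by (simp add: insert_absorb)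
  have "face_dim (\<tau> - {w}) = i" using c assms(2) by (auto simp: is_chain_def)
  moreover have "card \<tau> = Suc (card (\<tau> - {w}))"
    using w finite_face[OF assms(1) \<tau>] by (rule card.remove[rotated])
  ultimately show "face_dim \<tau> = i + 1" by (simp add: face_dim_def)
qed

text \<open>For a cycle the homotopy identity says that the cone over it has it as boundary. Only
  faces occurring in \<open>c\<close> must stay in \<open>Y\<close> when \<open>w\<close> is added,
  so \<open>Y\<close> itself need not be a cone.\<close>

lemma is_bdry_cone:
  assumes Y: "simplicial_complex Y" and c: "is_cycle Y i c"
    and w: "w \<in> \<Union>Y" "\<And>\<sigma>. c \<sigma> \<noteq> \<zero> \<Longrightarrow> insert w \<sigma> \<in> Y"
  shows "is_bdry Y i c"
proof -
  have ch: "is_chain Y i c" using c by (simp add: is_cycle_def)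
  have "bd (\<Union>Y) (cone w c) \<tau> = c \<tau>" for \<tau>
  proof -
    have "cone w (bd (\<Union>Y) c) \<tau> = \<zero>" using c by (simp add: cone_def is_cycle_def)
    moreover have "bd (\<Union>Y) (cone w c) \<tau> \<in> carrier F"
      using is_chain_closed[OF ch] by (intro bd_closed cone_closed)
    ultimately show ?thesis
      using bd_cone[OF finite_vertices[OF Y] is_chain_supported[OF ch] w(1), of \<tau>] by simp
  qed
  then have "c = bd (\<Union>Y) (cone w c)" by (intro ext) simp
  moreover have "is_chain Y (i + 1) (cone w c)" using is_chain_cone[OF Y ch] w(2) by blast
  ultimately show ?thesis unfolding is_bdry_def by blast
qed

lemma acyclic_simplex:
  assumes "finite A" "A \<noteq> {}"
  shows "acyclic_complex F (simplex (A :: 'a::linorder set))"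
proof -
  obtain w where w: "w \<in> A" using assms by blast
  have S: "simplicial_complex (simplex A)" using assms simplicial_complex_simplex by blast
  have "is_bdry (simplex A) i c" if "is_cycle (simplex A) i c" for i c
  proof (rule is_bdry_cone[OF S that, of w])
    show "w \<in> \<Union>(simplex A)" using w by (auto simp: simplex_def)
    fix \<sigma> assume "c \<sigma> \<noteq> \<zero>"
    then have "\<sigma> \<in> simplex A" using that by (auto simp: is_cycle_def is_chain_def)
    then show "insert w \<sigma> \<in> simplex A" using w by (auto simp: simplex_def)
  qed
  then show ?thesis using acyclic_iff[OF S] by blast
qed

text \<open>The part of a cycle that uses \<open>v\<close> is coned off from a vertex \<open>w\<close> of \<open>A\<close>; what
  remains is a cycle of \<open>L\<close>.\<close>

lemma acyclic_glue_simplex: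
  fixes L :: "'a::linorder set set"
  assumes L: "simplicial_complex L" and ac: "acyclic_complex F L"
    and A: "A \<in> L" "A \<noteq> {}" and v: "v \<notin> \<Union>L"
    and S: "simplicial_complex (L \<union> insert v ` Pow A)"
  shows "acyclic_complex F (L \<union> insert v ` Pow A)" (is "acyclic_complex F ?Y")
proof -
  let ?U = "\<Union>?Y"
  obtain w where w: "w \<in> A" using A by blast
  then have wv: "w \<noteq> v" and wU: "w \<in> ?U" using A v by auto
  have vL: "v \<notin> \<sigma>" if "\<sigma> \<in> L" for \<sigma> using that v by blast
  have "is_bdry ?Y i c" if c: "is_cycle ?Y i c" for i c
  proof -
    have cc: "is_chain ?Y i c" using c by (simp add: is_cycle_def)
    define c0 where "c0 = (\<lambda>\<tau>. if v \<in> \<tau> then c \<tau> else \<zero>)"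
    have c0: "is_chain ?Y i c0" using cc by (auto simp: c0_def is_chain_def)
    define k where "k = cone w c0"
    have k: "is_chain ?Y (i + 1) k"
      unfolding k_def
    proof (rule is_chain_cone[OF S c0])
      fix \<sigma> assume "c0 \<sigma> \<noteq> \<zero>"
      then have "\<sigma> \<in> ?Y" "v \<in> \<sigma>" using c0 by (auto simp: is_chain_def c0_def split: if_splits)
      then obtain \<rho> where "\<rho> \<subseteq> A" "\<sigma> = insert v \<rho>" using vL by auto
      then have "insert w \<sigma> = insert v (insert w \<rho>)" "insert w \<rho> \<subseteq> A" using w by auto
      then show "insert w \<sigma> \<in> ?Y" by blast
    qed
    \<comment> \<open>At a face containing \<open>v\<close> only faces containing \<open>v\<close>
      contribute to the boundary, so \<open>c0\<close> has there the zero boundary of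
      \<open>c\<close>. Removing \<open>w\<close> keeps \<open>v\<close> in the face, hence the
      second term of the homotopy identity vanishes.\<close>
    have kk: "bd ?U k \<tau> = c \<tau>" if "v \<in> \<tau>" for \<tau>
    proof -
      have "bd ?U c0 \<rho> = \<zero>" if "v \<in> \<rho>" for \<rho>
      proof -
        have "bd ?U c0 \<rho> = bd ?U c \<rho>" using that by (simp add: bd_def c0_def)
        then show ?thesis using c by (simp add: is_cycle_def)
      qed
      then have "cone w (bd ?U c0) \<tau> = \<zero>" using \<open>v \<in> \<tau>\<close> wv by (simp add: cone_def)
      moreover have "bd ?U k \<tau> \<in> carrier F"
        using is_chain_closed[OF k] by (intro bd_closed)
      ultimately show ?thesis
        using bd_cone[OF finite_vertices[OF S] is_chain_supported[OF c0] wU, of \<tau>] \<open>v \<in> \<tau>\<close>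
        by (simp add: k_def c0_def)
    qed
    define c' where "c' = (\<lambda>\<tau>. c \<tau> \<ominus> bd ?U k \<tau>)"
    have bk: "is_bdry ?Y i (bd ?U k)" using k unfolding is_bdry_def by blast
    have c': "is_cycle ?Y i c'"
      unfolding c'_def a_minus_def
      by (intro is_cycle_add c is_cycle_uminus[OF S] is_bdry_is_cycle[OF S bk])
    have c'L: "is_chain L i c'"
      unfolding is_chain_def
    proof (intro allI conjI impI)
      show "c' \<tau> \<in> carrier F" for \<tau> using is_cycle_closed[OF c'] .
      fix \<tau> assume *: "c' \<tau> \<noteq> \<zero>"
      then have "\<tau> \<in> ?Y" "face_dim \<tau> = i" using c' by (auto simp: is_cycle_def is_chain_def)
      moreover have "v \<notin> \<tau>"
      proof
        assume "v \<in> \<tau>"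
        then have "c' \<tau> = c \<tau> \<ominus> c \<tau>" unfolding c'_def by (simp only: kk)
        then show False using * is_chain_closed[OF cc, of \<tau>] by (simp only: r_neg a_minus_def)
      qed
      ultimately show "\<tau> \<in> L" "face_dim \<tau> = i" by auto
    qed
    then have "is_cycle L i c'"
      using c' bd_subcomplex[OF S _ c'L] by (simp add: is_cycle_def)
    then have "is_bdry L i c'" using ac acyclic_iff[OF L] by blast
    then obtain m where m: "is_chain L (i + 1) m" "c' = bd (\<Union>L) m" unfolding is_bdry_def by blast
    then have "c' = bd ?U m" using bd_subcomplex[OF S _ m(1)] by (intro ext) simp
    then have c'b: "is_bdry ?Y i c'" unfolding is_bdry_def using is_chain_mono[OF m(1)] by blast
    have "c = (\<lambda>\<tau>. c' \<tau> \<oplus> bd ?U k \<tau>)"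
      using is_chain_closed[OF cc] is_cycle_closed[OF is_bdry_is_cycle[OF S bk]]
      by (intro ext) (simp add: c'_def a_minus_def a_assoc l_neg)
    then show ?thesis using is_bdry_add[OF c'b bk] by simp
  qed
  then show ?thesis using acyclic_iff[OF S] by blast
qed

section \<open>Empty, one-point and two-point complexes; connectedness\<close>

lemma simplicial_complex_empty: "simplicial_complex {{}}"
  by (simp add: simplicial_complex_def)

lemma bd_no_vertices [simp]: "bd {} c \<tau> = \<zero>"
  by (simp add: bd_def)

lemma nontrivial_homology_empty:
  "\<not> trivial_module (reduced_homology F {{} :: 'a::linorder set} (-1))"
proof
  assume "trivial_module (reduced_homology F {{} :: 'a set} (-1))"
  moreover have "is_cycle {{} :: 'a set} (-1) (delta {})"
    by (simp add: is_cycle_def is_chain_def delta_def face_dim_def)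
  ultimately have "is_bdry {{} :: 'a set} (-1) (delta {})"
    using trivial_homology_iff[OF simplicial_complex_empty] by blast
  then have "delta {} ({} :: 'a set) = \<zero>" by (auto simp: is_bdry_def)
  then show False by (simp add: delta_def)
qed

lemma not_acyclic_empty: "\<not> acyclic_complex F {{} :: 'a::linorder set}"
  using nontrivial_homology_empty by (auto simp: acyclic_complex_def)

text \<open>The complex consisting of the empty face is the (-1)-sphere and the link of a facet. A
  cycle of degree -1 is its value at the empty face, and without vertices every boundary is zero.
  That the degree is forced to be -1 is what later gives maximal faces their size.\<close>

lemma sphere_empty_iff: "has_homology_of_sphere F n {{} :: 'a::linorder set} \<longleftrightarrow> n = -1"
proof
  assume "has_homology_of_sphere F n {{} :: 'a set}"
  then show "n = -1" using nontrivial_homology_empty by (auto simp: has_homology_of_sphere_def)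
next
  let ?X = "{{} :: 'a set}"
  have z: "c = (\<lambda>\<sigma>. \<zero>)" if "is_cycle ?X i c" "i = -1 \<Longrightarrow> c {} = \<zero>" for i c
  proof
    fix \<sigma> show "c \<sigma> = \<zero>"
      using that by (cases "\<sigma> = {}") (auto simp: is_cycle_def is_chain_def face_dim_def)
  qed
  have "module_isomorphic F (reduced_homology F ?X (-1)) (self_module F)"
  proof (rule homology_iso_fieldI[OF simplicial_complex_empty, where f = "\<lambda>c. c {}"])
    fix a assume "a \<in> carrier F"
    then have "is_cycle ?X (-1) (\<lambda>\<sigma>. if \<sigma> = {} then a else \<zero>)"
      by (simp add: is_cycle_def is_chain_def face_dim_def)
    then show "\<exists>c. is_cycle ?X (-1) c \<and> c {} = a"
      by (intro exI[of _ "\<lambda>\<sigma>. if \<sigma> = {} then a else \<zero>"]) simp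
  next
    fix c assume c: "is_cycle ?X (-1) c"
    show "c {} = \<zero> \<longleftrightarrow> is_bdry ?X (-1) c"
    proof
      assume "c {} = \<zero>"
      then show "is_bdry ?X (-1) c" using z[OF c] is_bdry_0[of ?X "-1"] by simp
    next
      assume "is_bdry ?X (-1) c"
      then show "c {} = \<zero>" by (auto simp: is_bdry_def)
    qed
  qed (auto simp: is_cycle_closed)
  moreover have "trivial_module (reduced_homology F ?X i)" if "i \<noteq> -1" for i
    unfolding trivial_homology_iff[OF simplicial_complex_empty]
    using that z[of i] is_bdry_0[of ?X i] by metis
  moreover assume "n = -1"
  ultimately show "has_homology_of_sphere F n ?X" by (simp add: has_homology_of_sphere_def)
qed

lemma bd_delta_vertex:
  assumes "finite U" "x \<in> U"
  shows "bd U (delta {x}) {} = \<one>"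
proof -
  have "bd U (delta {x}) {} = sg {} x \<otimes> delta {x} {x}"
    unfolding bd_def using assms by (intro finsum_eq_single) (auto simp: delta_def)
  then show ?thesis by (simp add: delta_def)
qed

text \<open>The boundary of a 0-chain has degree -1, so it lives on the empty face and only the
  augmentation has to be checked.\<close>

lemma is_cycle_0I:
  assumes "simplicial_complex L" "is_chain L 0 c" "bd (\<Union>L) c {} = \<zero>"
  shows "is_cycle L 0 c"
proof -
  have "bd (\<Union>L) c \<tau> = \<zero>" for \<tau>
  proof (cases "\<tau> = {}")
    case False
    have "\<not> (\<tau> \<in> L \<and> face_dim \<tau> = -1)"
      using False finite_face[OF assms(1)] by (auto simp: face_dim_def)
    then show ?thesis using is_chain_bd[OF assms(1,2)] by (auto simp: is_chain_def)
  qed (use assms in simp)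
  then show ?thesis using assms(2) by (simp add: is_cycle_def)
qed

lemma is_cycle_difference:
  assumes "simplicial_complex L" "{x} \<in> L" "{y} \<in> L"
  shows "is_cycle L 0 (\<lambda>\<sigma>. delta {x} \<sigma> \<ominus> delta {y} \<sigma>)"
proof (rule is_cycle_0I[OF assms(1)])
  show "is_chain L 0 (\<lambda>\<sigma>. delta {x} \<sigma> \<ominus> delta {y} \<sigma>)"
    using is_chain_delta[OF assms(2)] is_chain_delta[OF assms(3)]
    by (intro is_chain_minus) (simp_all add: face_dim_def)
  have "x \<in> \<Union>L" "y \<in> \<Union>L" using assms by auto
  then show "bd (\<Union>L) (\<lambda>\<sigma>. delta {x} \<sigma> \<ominus> delta {y} \<sigma>) {} = \<zero>"
    using finite_vertices[OF assms(1)]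
    by (subst bd_minus) (simp_all only: delta_closed bd_delta_vertex r_neg a_minus_def one_closed)
qed

lemma is_bdry_dim0:
  assumes "simplicial_complex L" "\<And>\<sigma>. \<sigma> \<in> L \<Longrightarrow> card \<sigma> \<le> 1" "is_bdry L 0 c"
  shows "c = (\<lambda>\<sigma>. \<zero>)"
proof -
  obtain e where e: "is_chain L 1 e" "c = bd (\<Union>L) e" using assms(3) by (auto simp: is_bdry_def)
  have "e \<sigma> = \<zero>" for \<sigma>
    using e(1) assms(2)[of \<sigma>] by (auto simp: is_chain_def face_dim_def)
  then have "e = (\<lambda>\<sigma>. \<zero>)" by blast
  then show ?thesis unfolding e(2) by (intro ext) simp
qed

text \<open>The difference of two distinct vertices is a nonzero cycle, which cannot bound in the
  absence of edges. No vertex at all would leave the (-1)-sphere.\<close>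

lemma acyclic_dim0:
  fixes L :: "'a::linorder set set"
  assumes L: "simplicial_complex L" and dim: "\<And>\<sigma>. \<sigma> \<in> L \<Longrightarrow> card \<sigma> \<le> 1"
    and ac: "acyclic_complex F L"
  shows "\<exists>x. L = {{}, {x}}"
proof -
  have "L \<noteq> {{}}" using ac not_acyclic_empty by blast
  moreover have "{} \<in> L" using L by (simp add: simplicial_complex_def)
  ultimately obtain x where x: "{x} \<in> L" using simplicial_complex_dim0[OF L dim] by blast
  have "y = x" if "{y} \<in> L" for y
  proof (rule ccontr)
    assume "y \<noteq> x"
    have "is_bdry L 0 (\<lambda>\<sigma>. delta {x} \<sigma> \<ominus> delta {y} \<sigma>)"
      using is_cycle_difference[OF L x that] ac acyclic_iff[OF L] by blast
    then have "delta {x} {x} \<ominus> delta {y} {x} = \<zero>"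
      using is_bdry_dim0[OF L dim] by meson
    then show False using \<open>y \<noteq> x\<close> by (simp add: delta_def a_minus_def)
  qed
  then have "L = {{}, {x}}" using x \<open>{} \<in> L\<close> simplicial_complex_dim0[OF L dim] by blast
  then show ?thesis by blast
qed

text \<open>Without edges all boundaries of degree 0 vanish, so every cycle is a multiple of a
  single \<open>z\<close>. One vertex carries no nonzero cycle. With a third vertex
  \<open>p\<close>, the cycle from \<open>x\<close> and \<open>y\<close> is a nonzero multiple of
  \<open>z\<close> and forces \<open>z {p}\<close> to vanish, whereas the cycle from
  \<open>p\<close> and \<open>x\<close> forbids this.\<close>

lemma sphere_dim0:
  fixes L :: "'a::linorder set set"
  assumes L: "simplicial_complex L" and dim: "\<And>\<sigma>. \<sigma> \<in> L \<Longrightarrow> card \<sigma> \<le> 1"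
    and sph: "has_homology_of_sphere F 0 L"
  shows "\<exists>x y. x \<noteq> y \<and> L = {{}, {x}, {y}}"
proof -
  have "L \<noteq> {{}}" using sph sphere_empty_iff[of 0, where 'a = 'a] by auto
  moreover have e: "{} \<in> L" using L by (simp add: simplicial_complex_def)
  ultimately obtain x where x: "{x} \<in> L" using simplicial_complex_dim0[OF L dim] by blast
  have iso: "module_isomorphic F (reduced_homology F L 0) (self_module F)"
    using sph by (simp add: has_homology_of_sphere_def)
  obtain z where z: "is_cycle L 0 z" "\<not> is_bdry L 0 z"
    "\<And>c. is_cycle L 0 c \<Longrightarrow> \<exists>a\<in>carrier F. \<exists>b. is_bdry L 0 b \<and> c = (\<lambda>\<sigma>. b \<sigma> \<oplus> a \<otimes> z \<sigma>)"
    by (rule homology_generator[OF L iso]) blast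
  have zcl: "z \<sigma> \<in> carrier F" for \<sigma> using is_cycle_closed[OF z(1)] .
  have gen: "\<exists>a\<in>carrier F. \<forall>\<sigma>. delta {p} \<sigma> \<ominus> delta {q} \<sigma> = a \<otimes> z \<sigma>" if pq: "{p} \<in> L" "{q} \<in> L" for p q
  proof -
    obtain a b where "a \<in> carrier F" "is_bdry L 0 b"
      and ab: "(\<lambda>\<sigma>. delta {p} \<sigma> \<ominus> delta {q} \<sigma>) = (\<lambda>\<sigma>. b \<sigma> \<oplus> a \<otimes> z \<sigma>)"
      using z(3)[OF is_cycle_difference[OF L pq]] by blast
    moreover have "b = (\<lambda>\<sigma>. \<zero>)" using is_bdry_dim0[OF L dim] calculation by blast
    ultimately have "\<forall>\<sigma>. delta {p} \<sigma> \<ominus> delta {q} \<sigma> = a \<otimes> z \<sigma>"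
      using zcl by (simp add: fun_eq_iff)
    then show ?thesis using \<open>a \<in> carrier F\<close> by blast
  qed
  have "\<exists>y. {y} \<in> L \<and> y \<noteq> x"
  proof (rule ccontr)
    assume "\<not> ?thesis"
    then have L1: "L = {{}, {x}}" using x e simplicial_complex_dim0[OF L dim] by blast
    then have "\<Union>L = {x}" by auto
    then have "bd (\<Union>L) z {} = z {x}" using zcl by (simp add: bd_def)
    then have zx: "z {x} = \<zero>" using z(1) by (simp add: is_cycle_def)
    have "z \<sigma> = \<zero>" for \<sigma>
    proof (cases "\<sigma> = {x}")
      case False
      then have "\<not> (\<sigma> \<in> L \<and> face_dim \<sigma> = 0)" by (auto simp: L1 face_dim_def)
      then show ?thesis using z(1) by (auto simp: is_cycle_def is_chain_def)
    qed (simp add: zx)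
    then have "z = (\<lambda>\<sigma>. \<zero>)" by blast
    then show False using z(2) is_bdry_0 by metis
  qed
  then obtain y where y: "{y} \<in> L" "y \<noteq> x" by blast
  have "p = x \<or> p = y" if p: "{p} \<in> L" for p
  proof (rule ccontr)
    assume np: "\<not> (p = x \<or> p = y)"
    obtain a where a: "a \<in> carrier F" "\<And>\<sigma>. delta {x} \<sigma> \<ominus> delta {y} \<sigma> = a \<otimes> z \<sigma>"
      using gen[OF x y(1)] by blast
    obtain b where b: "b \<in> carrier F" "\<And>\<sigma>. delta {p} \<sigma> \<ominus> delta {x} \<sigma> = b \<otimes> z \<sigma>"
      using gen[OF p x] by blast
    have "a \<otimes> z {x} = \<one>" using a(2)[of "{x}"] y by (simp add: delta_def a_minus_def)
    then have "a \<noteq> \<zero>" using zcl by auto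
    moreover have "a \<otimes> z {p} = \<zero>" using a(2)[of "{p}"] np by (simp add: delta_def a_minus_def)
    ultimately have "z {p} = \<zero>" using a(1) zcl integral by blast
    moreover have "b \<otimes> z {p} = \<one>" using b(2)[of "{p}"] np by (simp add: delta_def a_minus_def)
    ultimately show False using b(1) by simp
  qed
  then have "L = {{}, {x}, {y}}" using x y e simplicial_complex_dim0[OF L dim] by blast
  then show ?thesis using y by blast
qed

lemma simplicial_complex_two_points: "simplicial_complex {{}, {x}, {y}}"
  by (auto simp: simplicial_complex_def subset_singleton_iff)

lemma not_acyclic_two_points:
  assumes "x \<noteq> (y :: 'a::linorder)"
  shows "\<not> acyclic_complex F {{}, {x}, {y}}"
proof
  assume "acyclic_complex F {{}, {x}, {y}}"
  then obtain p where "{{}, {x}, {y}} = {{}, {p}}"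
    using acyclic_dim0[OF simplicial_complex_two_points[of x y]] by force
  then have "{x} \<in> {{}, {p}}" "{y} \<in> {{}, {p}}" by blast+
  then show False using assms by simp
qed

text \<open>The augmentation makes the values of a 0-cycle at the two points opposite, so evaluation
  at \<open>x\<close> is the required functional.\<close>

lemma sphere_two_points:
  assumes xy: "x \<noteq> (y :: 'a::linorder)"
  shows "has_homology_of_sphere F 0 {{}, {x}, {y}}" (is "has_homology_of_sphere F 0 ?X")
proof -
  have S: "simplicial_complex ?X" by (rule simplicial_complex_two_points)
  have dim: "\<And>\<sigma>. \<sigma> \<in> ?X \<Longrightarrow> card \<sigma> \<le> 1" by auto
  have U: "\<Union>?X = {x, y}" by auto
  have cy: "c {y} = \<ominus> c {x}" if c: "is_cycle ?X 0 c" for c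
  proof -
    have cl: "c \<sigma> \<in> carrier F" for \<sigma> using is_cycle_closed[OF c] .
    have "bd (\<Union>?X) c {} = c {x} \<oplus> c {y}" unfolding U using xy cl by (simp add: bd_def)
    then have "c {y} \<oplus> c {x} = \<zero>" using c cl by (simp add: is_cycle_def a_comm)
    then show ?thesis using cl by (metis minus_equality minus_minus)
  qed
  have z: "c = (\<lambda>\<sigma>. \<zero>)" if "is_cycle ?X 0 c" "c {x} = \<zero>" for c
  proof
    fix \<sigma> show "c \<sigma> = \<zero>"
    proof (cases "\<sigma> = {x} \<or> \<sigma> = {y}")
      case False
      then have "\<not> (\<sigma> \<in> ?X \<and> face_dim \<sigma> = 0)" by (auto simp: face_dim_def)
      then show ?thesis using that(1) by (auto simp: is_cycle_def is_chain_def)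
    qed (use that cy[of c] in auto)
  qed
  have "module_isomorphic F (reduced_homology F ?X 0) (self_module F)"
  proof (rule homology_iso_fieldI[OF S, where f = "\<lambda>c. c {x}"])
    fix a assume a: "a \<in> carrier F"
    have "is_cycle ?X 0 (\<lambda>\<sigma>. a \<otimes> (delta {x} \<sigma> \<ominus> delta {y} \<sigma>))"
      using is_cycle_difference[OF S] a by (intro is_cycle_smult[OF S]) auto
    moreover have "a \<otimes> (delta {x} {x} \<ominus> delta {y} {x}) = a"
      using a xy by (simp add: delta_def a_minus_def)
    ultimately show "\<exists>c. is_cycle ?X 0 c \<and> c {x} = a" by blast
  next
    fix c assume c: "is_cycle ?X 0 c"
    show "c {x} = \<zero> \<longleftrightarrow> is_bdry ?X 0 c"
      using z[OF c] is_bdry_0[of ?X 0] is_bdry_dim0[OF S dim, of c] by auto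
  qed (auto simp: is_cycle_closed)
  \<comment> \<open>Besides degree 0 only degree -1 has nonzero chains, and the empty face is coned
    off from \<open>x\<close>.\<close>
  moreover have "is_bdry ?X i c" if i: "i \<noteq> 0" and c: "is_cycle ?X i c" for i c
  proof (rule is_bdry_cone[OF S c, of x])
    fix \<sigma> assume "c \<sigma> \<noteq> \<zero>"
    then have "\<sigma> \<in> ?X" "face_dim \<sigma> = i" using c by (auto simp: is_cycle_def is_chain_def)
    then have "\<sigma> = {}" using i by (auto simp: face_dim_def)
    then show "insert x \<sigma> \<in> ?X" by simp
  qed simp
  ultimately show ?thesis
    using trivial_homology_iff[OF S] by (simp add: has_homology_of_sphere_def)
qed

text \<open>If \<open>v\<close> were outside the component \<open>C\<close> of \<open>u\<close>, let
  \<open>e\<close> be a 1-chain with boundary \<open>u\<close> minus \<open>v\<close>. No edge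
  leaves \<open>C\<close>, so the part of \<open>e\<close> inside \<open>C\<close> has boundary
  \<open>u\<close> alone. The augmentation of a boundary is zero, while that of \<open>u\<close> is
  one.\<close>

lemma acyclic_connected:
  fixes L :: "'a::linorder set set"
  assumes L: "simplicial_complex L" and ac: "acyclic_complex F L" and uv: "{u} \<in> L" "{v} \<in> L"
  shows "(\<lambda>a b. {a, b} \<in> L)\<^sup>*\<^sup>* u v"
proof (rule ccontr)
  assume nc: "\<not> ?thesis"
  define C where "C = {x. (\<lambda>a b. {a, b} \<in> L)\<^sup>*\<^sup>* u x}"
  have uC: "u \<in> C" and vC: "v \<notin> C" using nc by (auto simp: C_def)
  have step: "y \<in> C" if "x \<in> C" "{x, y} \<in> L" for x y
    using that unfolding C_def by (metis (mono_tags, lifting) mem_Collect_eq rtranclp.rtrancl_into_rtrancl)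
  obtain e where e: "is_chain L 1 e" "(\<lambda>\<sigma>. delta {u} \<sigma> \<ominus> delta {v} \<sigma>) = bd (\<Union>L) e"
    using is_cycle_difference[OF L uv] ac acyclic_iff[OF L] by (force simp: is_bdry_def)
  define e' where "e' = (\<lambda>\<tau>. if \<tau> \<subseteq> C then e \<tau> else \<zero>)"
  have e': "is_chain L 1 e'" using e(1) by (auto simp: e'_def is_chain_def)
  note cl = is_chain_closed[OF e(1)] is_chain_closed[OF e']
  have inC: "e' {x, y} = e {x, y}" if "x \<in> C" for x y
    using that step[of x y] is_chain_zero[OF e(1), of "{x, y}"] by (fastforce simp: e'_def)
  have b: "bd (\<Union>L) e' {x} = delta {u} {x}" if "x \<in> \<Union>L" for x
  proof (cases "x \<in> C")
    case True
    then have "bd (\<Union>L) e' {x} = bd (\<Union>L) e {x}"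
      unfolding bd_def by (simp add: insert_commute[of _ x] inC)
    also have "\<dots> = delta {u} {x} \<ominus> delta {v} {x}" using e(2) by metis
    also have "\<dots> = delta {u} {x}" using True vC by (auto simp: delta_def a_minus_def)
    finally show ?thesis .
  next
    case False
    then have "bd (\<Union>L) e' {x} = \<zero>"
      unfolding bd_def by (intro add.finprod_one_eqI) (simp add: e'_def)
    then show ?thesis using False uC by (auto simp: delta_def)
  qed
  have "bd (\<Union>L) (bd (\<Union>L) e') {} = bd (\<Union>L) (delta {u}) {}"
    unfolding bd_def[of _ "bd (\<Union>L) e'"] bd_def[of _ "delta {u}"]
    using b by (intro add.finprod_cong') auto
  also have "\<dots> = \<one>" using uv by (intro bd_delta_vertex finite_vertices[OF L]) auto
  finally show False using bd_bd[OF finite_vertices[OF L] is_chain_supported[OF e'], of "{}"] by simp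
qed

end

section \<open>Stellated spheres bound stacked balls\<close>

lemma complex_dim_eqI:
  assumes "finite X" "\<And>\<sigma>. \<sigma> \<in> X \<Longrightarrow> card \<sigma> \<le> k" "\<sigma> \<in> X" "card \<sigma> = k"
  shows "complex_dim X = int k - 1"
  unfolding complex_dim_def
proof (rule Max_eqI)
  show "int k - 1 \<in> face_dim ` X" using assms(3,4) by (auto simp: face_dim_def)
  show "y \<le> int k - 1" if y: "y \<in> face_dim ` X" for y
  proof -
    obtain \<tau> where "\<tau> \<in> X" "y = face_dim \<tau>" using y by blast
    then show ?thesis using assms(2)[of \<tau>] by (simp add: face_dim_def)
  qed
qed (use assms(1) in simp)

lemma complex_dim_eqD:
  assumes "simplicial_complex X" "complex_dim X = int k - 1"
  shows "\<And>\<sigma>. \<sigma> \<in> X \<Longrightarrow> card \<sigma> \<le> k" and "\<exists>\<sigma>\<in>X. card \<sigma> = k"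
proof -
  have fin: "finite (face_dim ` X)" and ne: "face_dim ` X \<noteq> {}"
    using assms(1) by (auto simp: simplicial_complex_def)
  show "card \<sigma> \<le> k" if "\<sigma> \<in> X" for \<sigma>
    using Max_ge[OF fin, of "face_dim \<sigma>"] that assms(2) by (simp add: complex_dim_def face_dim_def)
  have "int k - 1 \<in> face_dim ` X"
    using Max_in[OF fin ne] assms(2) by (simp add: complex_dim_def)
  then show "\<exists>\<sigma>\<in>X. card \<sigma> = k" by (auto simp: face_dim_def)
qed

lemma link_empty [simp]: "link {} X = X"
  by (simp add: link_def)

lemma link_maximal:
  assumes "\<sigma> \<in> X" "{} \<in> X" "\<And>\<tau>. \<tau> \<in> X \<Longrightarrow> \<sigma> \<subseteq> \<tau> \<Longrightarrow> \<tau> = \<sigma>"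
  shows "link \<sigma> X = {{}}"
  using assms(1,2) assms(3)[of "_ \<union> \<sigma>"] unfolding link_def by auto

text \<open>For a single vertex the boundary of \<open>{v}\<close> is only the empty face, so the
  removed join is the full simplex on \<open>\<alpha>\<close>. All its proper faces are put back, so
  that only \<open>\<alpha>\<close> disappears.\<close>

lemma bistellar_move_vertex_iff:
  "bistellar_move \<alpha> {v} X Y \<longleftrightarrow>
     simplicial_complex X \<and> \<alpha> \<in> X \<and> \<alpha> \<noteq> {} \<and> face_dim \<alpha> = complex_dim X \<and> v \<notin> \<Union>X \<and>
     Y = X - {\<alpha>} \<union> insert v ` {\<rho>. \<rho> \<subset> \<alpha>}"
proof -
  have j1: "join (simplex \<alpha>) (simplex_boundary {v}) = Pow \<alpha>"
  proof -
    have "\<tau> \<subset> {v} \<longleftrightarrow> \<tau> = {}" for \<tau> by blast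
    then show ?thesis by (simp add: join_def simplex_def simplex_boundary_def Pow_def)
  qed
  have "join (simplex_boundary \<alpha>) (simplex {v}) = {\<rho> \<union> \<tau> |\<rho> \<tau>. \<rho> \<subset> \<alpha> \<and> (\<tau> = {} \<or> \<tau> = {v})}"
    by (auto simp: join_def simplex_def simplex_boundary_def subset_singleton_iff)
  also have "\<dots> = {\<rho> \<union> {} |\<rho>. \<rho> \<subset> \<alpha>} \<union> {\<rho> \<union> {v} |\<rho>. \<rho> \<subset> \<alpha>}" by blast
  also have "\<dots> = {\<rho>. \<rho> \<subset> \<alpha>} \<union> insert v ` {\<rho>. \<rho> \<subset> \<alpha>}" by (simp add: setcompr_eq_image)
  finally have j2: "join (simplex_boundary \<alpha>) (simplex {v}) = {\<rho>. \<rho> \<subset> \<alpha>} \<union> insert v ` {\<rho>. \<rho> \<subset> \<alpha>}" .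
  have ind: "v \<notin> \<alpha> \<and> induced X (\<alpha> \<union> {v}) = Pow \<alpha> \<longleftrightarrow> \<alpha> \<in> X \<and> v \<notin> \<Union>X"
    if X: "simplicial_complex X"
  proof
    assume *: "v \<notin> \<alpha> \<and> induced X (\<alpha> \<union> {v}) = Pow \<alpha>"
    then have "\<alpha> \<in> X" by (auto simp: induced_def)
    moreover have "{v} \<notin> X" using * unfolding induced_def by blast
    then have "v \<notin> \<Union>X" using face_subset[OF X, of _ "{v}"] by blast
    ultimately show "\<alpha> \<in> X \<and> v \<notin> \<Union>X" by blast
  next
    assume *: "\<alpha> \<in> X \<and> v \<notin> \<Union>X"
    then show "v \<notin> \<alpha> \<and> induced X (\<alpha> \<union> {v}) = Pow \<alpha>"
      using face_subset[OF X] unfolding induced_def by blast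
  qed
  have Y: "X - Pow \<alpha> \<union> ({\<rho>. \<rho> \<subset> \<alpha>} \<union> Z) = X - {\<alpha>} \<union> Z"
    if "simplicial_complex X" "\<alpha> \<in> X" for Z
    using face_subset[OF that] by auto
  show ?thesis
    unfolding bistellar_move_def j1 j2
    using ind Y finite_face[of X \<alpha>] by (auto simp: face_dim_def)
qed

section \<open>From moves of index 0 to a stacked ball\<close>

context coeff_field
begin

text \<open>Combinatorial shape of a 1-stacked ball of dimension \<open>m + 1\<close>, without the
  requirement that its boundary be a homology sphere.\<close>

definition stacked_complex :: "nat \<Rightarrow> 'a::linorder set set \<Rightarrow> bool" where
  "stacked_complex m B \<longleftrightarrow> simplicial_complex B \<and> (\<forall>\<sigma>\<in>B. card \<sigma> \<le> m + 2) \<and>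
     (\<exists>\<sigma>\<in>B. card \<sigma> = m + 2) \<and>
     (\<forall>\<sigma>\<in>B. acyclic_complex F (link \<sigma> B) \<or> (card \<sigma> = m + 2 \<and> link \<sigma> B = {{}}) \<or>
        (card \<sigma> = m + 1 \<and> (\<exists>x y. x \<noteq> y \<and> link \<sigma> B = {{}, {x}, {y}})))"

lemma stacked_complexD:
  assumes "stacked_complex m B"
  shows "simplicial_complex B" "\<And>\<sigma>. \<sigma> \<in> B \<Longrightarrow> card \<sigma> \<le> m + 2"
    "\<And>\<sigma>. \<sigma> \<in> B \<Longrightarrow> card \<sigma> \<le> m \<Longrightarrow> acyclic_complex F (link \<sigma> B)"
  using assms unfolding stacked_complex_def by force+

text \<open>Empty links of facets are (-1)-spheres and two-point links of ridges are 0-spheres. All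
  faces of codimension at least 2 have acyclic links, hence lie in the boundary.\<close>

lemma stacked_ball_if_stacked_complex:
  assumes B: "stacked_complex m B" and S: "F_homology_sphere F (int m) (ball_boundary F B)"
  shows "F_stacked_ball F 1 (int m + 1) B"
proof -
  note D = stacked_complexD[OF B]
  have "finite B" "{} \<in> B" using D(1) by (auto simp: simplicial_complex_def)
  obtain \<sigma> where "\<sigma> \<in> B" "card \<sigma> = m + 2" using B unfolding stacked_complex_def by blast
  then have "complex_dim B = int (m + 2) - 1"
    using complex_dim_eqI[OF \<open>finite B\<close> D(2)] by blast
  moreover have "acyclic_complex F B" using D(3)[of "{}"] \<open>{} \<in> B\<close> by simp
  moreover have "has_homology_of_sphere F (int m + 1 - face_dim \<sigma> - 1) (link \<sigma> B) \<or>
      acyclic_complex F (link \<sigma> B)" if "\<sigma> \<in> B" for \<sigma>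
  proof -
    have "acyclic_complex F (link \<sigma> B) \<or> (card \<sigma> = m + 2 \<and> link \<sigma> B = {{}}) \<or>
        (card \<sigma> = m + 1 \<and> (\<exists>x y. x \<noteq> y \<and> link \<sigma> B = {{}, {x}, {y}}))"
      using B that unfolding stacked_complex_def by (elim conjE) (rule bspec)
    then consider "acyclic_complex F (link \<sigma> B)" | "card \<sigma> = m + 2" "link \<sigma> B = {{}}"
      | "card \<sigma> = m + 1" "\<exists>x y. x \<noteq> y \<and> link \<sigma> B = {{}, {x}, {y}}"
      by (elim disjE conjE)
    then show ?thesis
    proof cases
      case 2
      then show ?thesis by (simp add: face_dim_def sphere_empty_iff)
    next
      case 3
      then obtain x y where "x \<noteq> y" "link \<sigma> B = {{}, {x}, {y}}" by blast
      then show ?thesis using 3(1) sphere_two_points[of x y] by (simp add: face_dim_def)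
    qed blast
  qed
  moreover have "\<sigma> \<in> ball_boundary F B" if "\<sigma> \<in> B" "int m + 1 - face_dim \<sigma> \<ge> 1 + 1" for \<sigma>
    using that D(3)[of \<sigma>] by (auto simp: ball_boundary_def face_dim_def)
  ultimately show ?thesis
    using D(1) S unfolding F_stacked_ball_def F_homology_ball_def by simp
qed

lemma simplex_stacked_complex:
  assumes V: "finite (V :: 'a::linorder set)" "card V = m + 2"
  shows "stacked_complex m (simplex V)" and "ball_boundary F (simplex V) = simplex_boundary V"
proof -
  have lk: "link \<sigma> (simplex V) = simplex (V - \<sigma>)" if "\<sigma> \<subseteq> V" for \<sigma>
    using that by (auto simp: link_def simplex_def)
  have ac: "acyclic_complex F (link \<sigma> (simplex V))" if "\<sigma> \<subset> V" for \<sigma>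
    using that V lk[of \<sigma>] acyclic_simplex[of "V - \<sigma>"] by auto
  have lkV: "link V (simplex V) = {{}}" using lk[of V] by (simp add: simplex_def)
  show "stacked_complex m (simplex V)"
    unfolding stacked_complex_def
  proof (intro conjI ballI)
    show "\<exists>\<sigma>\<in>simplex V. card \<sigma> = m + 2" using V by (auto simp: simplex_def)
    fix \<sigma> assume "\<sigma> \<in> simplex V"
    then have \<sigma>: "\<sigma> \<subset> V \<or> \<sigma> = V" by (auto simp: simplex_def)
    then show "card \<sigma> \<le> m + 2" using V card_mono[OF V(1), of \<sigma>] by auto
    show "acyclic_complex F (link \<sigma> (simplex V)) \<or> card \<sigma> = m + 2 \<and> link \<sigma> (simplex V) = {{}} \<or>
        card \<sigma> = m + 1 \<and> (\<exists>x y. x \<noteq> y \<and> link \<sigma> (simplex V) = {{}, {x}, {y}})"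
      using \<sigma> ac lkV V(2) by blast
  qed (rule simplicial_complex_simplex[OF V(1)])
  show "ball_boundary F (simplex V) = simplex_boundary V"
    using ac lkV not_acyclic_empty[where 'a = 'a]
    by (auto simp: ball_boundary_def simplex_boundary_def simplex_def psubset_eq)
qed

text \<open>As \<open>v\<close> is new, a face containing it is \<open>v\<close> joined to a face of
  \<open>\<alpha>\<close>. Thus among the old faces only those below \<open>\<alpha>\<close> acquire
  a larger link.\<close>

lemma link_attach:
  assumes B: "simplicial_complex B" and \<alpha>: "\<alpha> \<in> B" and v: "v \<notin> \<Union>B"
  defines "B' \<equiv> B \<union> insert v ` Pow \<alpha>"
  shows "simplicial_complex B'"
    and "\<And>\<sigma>. \<sigma> \<in> B \<Longrightarrow> \<not> \<sigma> \<subseteq> \<alpha> \<Longrightarrow> link \<sigma> B' = link \<sigma> B"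
    and "\<And>\<sigma>. \<sigma> \<subseteq> \<alpha> \<Longrightarrow> link \<sigma> B' = link \<sigma> B \<union> insert v ` Pow (\<alpha> - \<sigma>)"
    and "\<And>\<rho>. \<rho> \<subseteq> \<alpha> \<Longrightarrow> link (insert v \<rho>) B' = simplex (\<alpha> - \<rho>)"
proof -
  have PB: "\<rho> \<in> B" if "\<rho> \<subseteq> \<alpha>" for \<rho> using that face_subset[OF B \<alpha>] by blast
  have vB: "v \<notin> \<sigma>" if "\<sigma> \<in> B" for \<sigma> using that v by blast
  have v\<alpha>: "v \<notin> \<alpha>" using vB \<alpha> by blast
  have mem: "\<tau> \<in> B' \<longleftrightarrow> (if v \<in> \<tau> then \<tau> - {v} \<subseteq> \<alpha> else \<tau> \<in> B)" for \<tau>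
  proof (cases "v \<in> \<tau>")
    case True
    then have "\<tau> \<notin> B" using vB by blast
    moreover have "\<tau> \<in> insert v ` Pow \<alpha> \<longleftrightarrow> \<tau> - {v} \<subseteq> \<alpha>"
    proof
      assume "\<tau> - {v} \<subseteq> \<alpha>"
      then show "\<tau> \<in> insert v ` Pow \<alpha>" using True by (intro image_eqI[of _ _ "\<tau> - {v}"]) auto
    qed auto
    ultimately show ?thesis using True by (simp add: B'_def)
  qed (auto simp: B'_def)
  have "\<tau> \<in> B'" if "\<sigma> \<in> B'" "\<tau> \<subseteq> \<sigma>" for \<sigma> \<tau>
  proof (cases "v \<in> \<sigma>")
    case True
    then have "\<tau> - {v} \<subseteq> \<alpha>" using that mem by auto
    then show ?thesis using mem[of \<tau>] PB[of "\<tau> - {v}"] by (auto split: if_splits)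
  next
    case False
    then show ?thesis using that mem[of \<tau>] mem[of \<sigma>] face_subset[OF B] by auto
  qed
  moreover have fin: "finite \<alpha>" "finite B" "{} \<in> B"
    using B \<alpha> finite_face by (auto simp: simplicial_complex_def)
  moreover have "finite \<sigma>" if "\<sigma> \<in> B'" for \<sigma>
    using that fin finite_face[OF B] unfolding B'_def by (auto intro: finite_subset)
  ultimately show "simplicial_complex B'"
    unfolding simplicial_complex_def by (auto simp: B'_def)
  show "link \<sigma> B' = link \<sigma> B" if "\<sigma> \<in> B" "\<not> \<sigma> \<subseteq> \<alpha>" for \<sigma>
  proof -
    have "\<tau> \<union> \<sigma> \<in> B' \<longleftrightarrow> \<tau> \<union> \<sigma> \<in> B" for \<tau> using that vB mem[of "\<tau> \<union> \<sigma>"] vB[of "\<tau> \<union> \<sigma>"] by auto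
    then show ?thesis using face_subset[OF B] unfolding link_def B'_def by blast
  qed
  show "link \<sigma> B' = link \<sigma> B \<union> insert v ` Pow (\<alpha> - \<sigma>)" if "\<sigma> \<subseteq> \<alpha>" for \<sigma>
  proof (rule Set.set_eqI)
    fix \<tau>
    have "v \<notin> \<sigma>" using that v\<alpha> by blast
    show "\<tau> \<in> link \<sigma> B' \<longleftrightarrow> \<tau> \<in> link \<sigma> B \<union> insert v ` Pow (\<alpha> - \<sigma>)"
    proof (cases "v \<in> \<tau>")
      case True
      then have "\<tau> \<notin> link \<sigma> B" using vB by (auto simp: link_def)
      moreover have "\<tau> \<in> insert v ` Pow (\<alpha> - \<sigma>) \<longleftrightarrow> \<tau> - {v} \<subseteq> \<alpha> - \<sigma>"
        using True v\<alpha> by (auto intro!: image_eqI[of _ _ "\<tau> - {v}"])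
      moreover have "\<tau> \<in> link \<sigma> B' \<longleftrightarrow> \<tau> - {v} \<subseteq> \<alpha> - \<sigma>"
        using True that \<open>v \<notin> \<sigma>\<close> by (auto simp: link_def mem)
      ultimately show ?thesis by blast
    next
      case False
      then show ?thesis using \<open>v \<notin> \<sigma>\<close> by (auto simp: link_def mem)
    qed
  qed
  show "link (insert v \<rho>) B' = simplex (\<alpha> - \<rho>)" if "\<rho> \<subseteq> \<alpha>" for \<rho>
    using that v\<alpha> PB by (auto simp: link_def simplex_def mem split: if_splits)
qed

text \<open>A proper face of \<open>\<alpha>\<close> has at most \<open>m\<close> vertices, so its
  link is acyclic and remains so when a simplex is glued on along a nonempty face. The link of
  \<open>\<alpha>\<close> grows from one point to two, so \<open>\<alpha>\<close> leaves the
  boundary. New faces other than the new facet have nonempty simplices as links and enter it. This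
  is the effect of a move of index 0.\<close>

lemma stacked_complex_attach:
  fixes B :: "'a::linorder set set"
  assumes B: "stacked_complex m B" and \<alpha>: "\<alpha> \<in> ball_boundary F B" "card \<alpha> = m + 1"
    and v: "v \<notin> \<Union>B"
  shows "stacked_complex m (B \<union> insert v ` Pow \<alpha>)"
    and "ball_boundary F (B \<union> insert v ` Pow \<alpha>)
      = ball_boundary F B - {\<alpha>} \<union> insert v ` {\<rho>. \<rho> \<subset> \<alpha>}"
proof -
  let ?B = "B \<union> insert v ` Pow \<alpha>"
  note D = stacked_complexD[OF B]
  have \<alpha>B: "\<alpha> \<in> B" and ac\<alpha>: "acyclic_complex F (link \<alpha> B)" using \<alpha> by (auto simp: ball_boundary_def)
  note lk = link_attach[OF D(1) \<alpha>B v]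
  have fin: "finite \<alpha>" using finite_face[OF D(1) \<alpha>B] .
  have vB: "v \<notin> \<sigma>" if "\<sigma> \<in> B" for \<sigma> using that v by blast
  have below: "acyclic_complex F (link \<sigma> ?B)" "acyclic_complex F (link \<sigma> B)" if "\<sigma> \<subset> \<alpha>" for \<sigma>
  proof -
    have \<sigma>: "\<sigma> \<in> B" "card \<sigma> \<le> m"
      using that face_subset[OF D(1) \<alpha>B] psubset_card_mono[OF fin that] \<alpha>(2) by auto
    then show ac: "acyclic_complex F (link \<sigma> B)" by (rule D(3))
    have eq: "link \<sigma> ?B = link \<sigma> B \<union> insert v ` Pow (\<alpha> - \<sigma>)" using lk(3) that by blast
    have "acyclic_complex F (link \<sigma> B \<union> insert v ` Pow (\<alpha> - \<sigma>))"
    proof (rule acyclic_glue_simplex[OF simplicial_complex_link[OF D(1) \<sigma>(1)] ac])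
      have "\<alpha> - \<sigma> \<union> \<sigma> = \<alpha>" using that by blast
      then show "\<alpha> - \<sigma> \<in> link \<sigma> B"
        using \<alpha>B face_subset[OF D(1) \<alpha>B] by (auto simp: link_def)
      show "\<alpha> - \<sigma> \<noteq> {}" using that by blast
      show "v \<notin> \<Union>(link \<sigma> B)" using v by (auto simp: link_def)
      show "simplicial_complex (link \<sigma> B \<union> insert v ` Pow (\<alpha> - \<sigma>))"
        using simplicial_complex_link[OF lk(1), of \<sigma>] \<sigma>(1) eq by simp
    qed
    then show "acyclic_complex F (link \<sigma> ?B)" using eq by simp
  qed
  have "\<exists>x. link \<alpha> B = {{}, {x}}"
  proof (rule acyclic_dim0[OF simplicial_complex_link[OF D(1) \<alpha>B] _ ac\<alpha>])
    fix \<tau> assume "\<tau> \<in> link \<alpha> B"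
    then have "card (\<tau> \<union> \<alpha>) \<le> m + 2" "\<tau> \<inter> \<alpha> = {}" "finite \<tau>"
      using D(2) finite_face[OF D(1)] by (auto simp: link_def)
    then show "card \<tau> \<le> 1" using fin \<alpha>(2) by (simp add: card_Un_disjoint)
  qed
  then obtain x where x: "link \<alpha> B = {{}, {x}}" by blast
  then have xv: "x \<noteq> v" using v by (auto simp: link_def)
  have lk\<alpha>: "link \<alpha> ?B = {{}, {x}, {v}}" using lk(3)[of \<alpha>] x by auto
  have top: "link (insert v \<alpha>) ?B = {{}}" using lk(4)[of \<alpha>] by (simp add: simplex_def)
  have new: "acyclic_complex F (link (insert v \<rho>) ?B)" if "\<rho> \<subset> \<alpha>" for \<rho>
    using lk(4)[of \<rho>] that fin acyclic_simplex[of "\<alpha> - \<rho>"] by auto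
  have cardtop: "card (insert v \<alpha>) = m + 2" using vB[OF \<alpha>B] fin \<alpha>(2) by simp
  show "stacked_complex m ?B"
    unfolding stacked_complex_def
  proof (intro conjI ballI)
    show "simplicial_complex ?B" by (rule lk(1))
    show "\<exists>\<sigma>\<in>?B. card \<sigma> = m + 2" using cardtop by blast
    fix \<sigma> assume \<sigma>: "\<sigma> \<in> ?B"
    show "card \<sigma> \<le> m + 2"
    proof (cases "\<sigma> \<in> B")
      case False
      then have "\<sigma> \<subseteq> insert v \<alpha>" using \<sigma> by auto
      then show ?thesis using card_mono[of "insert v \<alpha>" \<sigma>] fin cardtop by simp
    qed (use D(2) in blast)
    consider "\<sigma> \<in> B" "\<not> \<sigma> \<subseteq> \<alpha>" | "\<sigma> \<subset> \<alpha>" | "\<sigma> = \<alpha>" | \<rho> where "\<sigma> = insert v \<rho>" "\<rho> \<subset> \<alpha>" | "\<sigma> = insert v \<alpha>"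
      using \<sigma> by blast
    then show "acyclic_complex F (link \<sigma> ?B) \<or> card \<sigma> = m + 2 \<and> link \<sigma> ?B = {{}} \<or>
         card \<sigma> = m + 1 \<and> (\<exists>x y. x \<noteq> y \<and> link \<sigma> ?B = {{}, {x}, {y}})"
    proof cases
      case 1
      then show ?thesis using B lk(2) unfolding stacked_complex_def by metis
    next
      case 2
      then show ?thesis using below by blast
    next
      case 3
      then show ?thesis using lk\<alpha> xv \<alpha>(2) by blast
    next
      case 4
      then show ?thesis using new by blast
    next
      case 5
      then show ?thesis using top cardtop by blast
    qed
  qed
  have n\<alpha>: "\<not> acyclic_complex F (link \<alpha> ?B)" using lk\<alpha> xv not_acyclic_two_points by metis
  have ntop: "\<not> acyclic_complex F (link (insert v \<alpha>) ?B)" using top not_acyclic_empty by metis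
  show "ball_boundary F ?B = ball_boundary F B - {\<alpha>} \<union> insert v ` {\<rho>. \<rho> \<subset> \<alpha>}"
  proof (rule Set.set_eqI)
    fix \<sigma>
    show "\<sigma> \<in> ball_boundary F ?B \<longleftrightarrow> \<sigma> \<in> ball_boundary F B - {\<alpha>} \<union> insert v ` {\<rho>. \<rho> \<subset> \<alpha>}"
    proof (cases "v \<in> \<sigma>")
      case True
      then have nB: "\<sigma> \<notin> B" using vB by blast
      show ?thesis
      proof
        assume "\<sigma> \<in> ball_boundary F ?B"
        then have "\<sigma> \<in> ?B" and ac: "acyclic_complex F (link \<sigma> ?B)" by (simp_all add: ball_boundary_def)
        then obtain \<rho> where "\<rho> \<subseteq> \<alpha>" "\<sigma> = insert v \<rho>" using nB by blast
        moreover have "\<rho> \<noteq> \<alpha>" using ac ntop calculation by metis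
        ultimately show "\<sigma> \<in> ball_boundary F B - {\<alpha>} \<union> insert v ` {\<rho>. \<rho> \<subset> \<alpha>}" by blast
      next
        assume "\<sigma> \<in> ball_boundary F B - {\<alpha>} \<union> insert v ` {\<rho>. \<rho> \<subset> \<alpha>}"
        moreover have "\<sigma> \<notin> ball_boundary F B" using nB by (simp add: ball_boundary_def)
        ultimately obtain \<rho> where "\<rho> \<subset> \<alpha>" "\<sigma> = insert v \<rho>" by blast
        moreover from this have "\<sigma> \<in> ?B" by blast
        ultimately show "\<sigma> \<in> ball_boundary F ?B" using new unfolding ball_boundary_def by simp
      qed
    next
      case False
      then have *: "\<sigma> \<in> ?B \<longleftrightarrow> \<sigma> \<in> B" "\<sigma> \<notin> insert v ` {\<rho>. \<rho> \<subset> \<alpha>}" by auto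
      consider "\<sigma> = \<alpha>" | "\<sigma> \<subset> \<alpha>" | "\<not> \<sigma> \<subseteq> \<alpha>" by blast
      then show ?thesis
      proof cases
        case 1
        then show ?thesis using n\<alpha> * by (simp add: ball_boundary_def)
      next
        case 2
        then show ?thesis using below * unfolding ball_boundary_def by blast
      next
        case 3
        then show ?thesis using lk(2)[of \<sigma>] * unfolding ball_boundary_def by auto
      qed
    qed
  qed
qed

text \<open>Induction along the moves, gluing one simplex per move. Positivity of \<open>m\<close>
  makes every vertex of \<open>B\<close> a boundary vertex, so that a vertex new to the sphere is
  new to the ball.\<close>

lemma stellated_imp_stacked_complex:
  fixes X :: "'a::linorder set set"
  assumes m: "0 < m" and st: "stellated 1 (int m) X"
  shows "\<exists>B. stacked_complex m B \<and> X = ball_boundary F B"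
proof -
  obtain V :: "'a set" where V: "finite V" "face_dim V = int m + 1"
    and rt: "(\<lambda>Y Z. \<exists>\<alpha> \<beta>. bistellar_move \<alpha> \<beta> Y Z \<and> face_dim \<beta> < 1)\<^sup>*\<^sup>* (simplex_boundary V) X"
    using st by (auto simp: stellated_def)
  have cV: "card V = m + 2" using V by (simp add: face_dim_def)
  \<comment> \<open>The dimension is carried along because it gives the size of the face
    \<open>\<alpha>\<close> at which the next move takes place.\<close>
  from rt have "(\<exists>B. stacked_complex m B \<and> X = ball_boundary F B) \<and> complex_dim X = int m"
  proof (induction rule: rtranclp_induct)
    case base
    obtain x where x: "x \<in> V" using cV by fastforce
    have "complex_dim (simplex_boundary V) = int (m + 1) - 1"
    proof (rule complex_dim_eqI)
      show "finite (simplex_boundary V)" using V(1) by (simp add: simplex_boundary_def psubset_eq)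
      show "card \<sigma> \<le> m + 1" if "\<sigma> \<in> simplex_boundary V" for \<sigma>
        using that psubset_card_mono[OF V(1), of \<sigma>] cV by (simp add: simplex_boundary_def)
      show "V - {x} \<in> simplex_boundary V" using x by (auto simp: simplex_boundary_def)
      show "card (V - {x}) = m + 1" using x cV V(1) by simp
    qed
    then show ?case using simplex_stacked_complex[OF V(1) cV] by auto
  next
    case (step Y Z)
    then obtain B where B: "stacked_complex m B" and Y: "Y = ball_boundary F B" "complex_dim Y = int m"
      by blast
    obtain \<alpha> \<beta> where mv: "bistellar_move \<alpha> \<beta> Y Z" "face_dim \<beta> < 1" using step by blast
    then have "finite \<beta>" "\<beta> \<noteq> {}" by (auto simp: bistellar_move_def)
    then have "card \<beta> = 1" using mv(2) card_gt_0_iff[of \<beta>] by (simp add: face_dim_def)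
    then obtain v where v: "\<beta> = {v}" by (auto simp: card_1_singleton_iff)
    have *: "simplicial_complex Y" "\<alpha> \<in> Y" "face_dim \<alpha> = int m" "v \<notin> \<Union>Y"
      "Z = Y - {\<alpha>} \<union> insert v ` {\<rho>. \<rho> \<subset> \<alpha>}"
      using mv(1) Y(2) unfolding v bistellar_move_vertex_iff by auto
    have c\<alpha>: "card \<alpha> = m + 1" using *(3) by (simp add: face_dim_def)
    note D = stacked_complexD[OF B]
    \<comment> \<open>A vertex has one element, and \<open>1 \<le> m\<close> puts it among the faces
      of codimension at least 2.\<close>
    have "v \<notin> \<Union>B"
    proof
      assume "v \<in> \<Union>B"
      then have "{v} \<in> B" using face_subset[OF D(1), of _ "{v}"] by blast
      then have "{v} \<in> Y" using D(3)[of "{v}"] m by (simp add: Y ball_boundary_def)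
      then show False using *(4) by blast
    qed
    then have "stacked_complex m (B \<union> insert v ` Pow \<alpha>) \<and> Z = ball_boundary F (B \<union> insert v ` Pow \<alpha>)"
      using stacked_complex_attach[OF B _ c\<alpha>] *(2,5) Y(1) by simp
    moreover have "complex_dim Z = int (m + 1) - 1"
    proof -
      have fin\<alpha>: "finite \<alpha>" using finite_face[OF *(1,2)] .
      obtain x where x: "x \<in> \<alpha>" using c\<alpha> by fastforce
      have v\<alpha>: "v \<notin> \<alpha>" using *(2,4) by blast
      have Yc: "card \<sigma> \<le> m + 1" if "\<sigma> \<in> Y" for \<sigma>
        using complex_dim_eqD(1)[OF *(1), of "m + 1"] Y(2) that by simp
      show ?thesis
      proof (rule complex_dim_eqI)
        show "finite Z" using *(1,5) fin\<alpha> by (simp add: simplicial_complex_def psubset_eq)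
        show "insert v (\<alpha> - {x}) \<in> Z" unfolding *(5) using x by blast
        show "card (insert v (\<alpha> - {x})) = m + 1" using x v\<alpha> fin\<alpha> c\<alpha> by simp
        fix \<sigma> assume "\<sigma> \<in> Z"
        then consider "\<sigma> \<in> Y" | \<rho> where "\<sigma> = insert v \<rho>" "\<rho> \<subset> \<alpha>" unfolding *(5) by blast
        then show "card \<sigma> \<le> m + 1"
        proof cases
          case 2
          then have "card \<rho> < m + 1" using psubset_card_mono[OF fin\<alpha>, of \<rho>] c\<alpha> by simp
          then show ?thesis using 2 card_insert_le_m1[of "m + 1" \<rho> v] by simp
        qed (use Yc in blast)
      qed
    qed
    ultimately show ?case by auto
  qed
  then show ?thesis by blast
qed

text \<open>For \<open>m = 0\<close> an inner vertex of the path \<open>B\<close> may be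
  reintroduced by a move, so gluing can fail. Instead the 0-sphere is recognised as two points, the
  boundary of one edge.\<close>

lemma homology_sphere_dim0:
  fixes X :: "'a::linorder set set"
  assumes "F_homology_sphere F 0 X"
  shows "\<exists>B. stacked_complex 0 B \<and> X = ball_boundary F B"
proof -
  have X: "simplicial_complex X" "complex_dim X = 0" "has_homology_of_sphere F 0 X"
    using assms unfolding F_homology_sphere_def simplicial_complex_def
    by (auto simp: face_dim_def dest: bspec[of _ _ "{}"])
  then have "card \<sigma> \<le> 1" if "\<sigma> \<in> X" for \<sigma> using complex_dim_eqD(1)[of X 1] that by simp
  then obtain x y where xy: "x \<noteq> y" "X = {{}, {x}, {y}}" using sphere_dim0[OF X(1) _ X(3)] by blast
  have "X = simplex_boundary {x, y}"
  proof (rule Set.set_eqI)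
    fix \<sigma> show "\<sigma> \<in> X \<longleftrightarrow> \<sigma> \<in> simplex_boundary {x, y}"
      using xy unfolding simplex_boundary_def psubset_eq by auto
  qed
  then show ?thesis using simplex_stacked_complex[of "{x, y}" 0] xy(1) by auto
qed

end

text \<open>The field over which \<open>X\<close> is a sphere also serves for the ball, so the
  sphere condition on the boundary of the ball is the hypothesis.\<close>

lemma stellated_imp_stacked:
  fixes X :: "'a::linorder set set"
  assumes sph: "homology_sphere TYPE('f) (int m) X" and st: "stellated 1 (int m) X"
  shows "stacked_sphere TYPE('f) 1 (int m) X"
proof -
  obtain F :: "'f ring" where F: "field F" "F_homology_sphere F (int m) X"
    using sph by (auto simp: homology_sphere_def)
  interpret coeff_field F using F(1) by (simp add: coeff_field_def)
  obtain B where "stacked_complex m B" "X = ball_boundary F B"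
    using homology_sphere_dim0[of X] stellated_imp_stacked_complex[OF _ st] F(2)
    by (cases "m = 0") auto
  then have "F_stacked_ball F 1 (int m + 1) B \<and> X = ball_boundary F B"
    using stacked_ball_if_stacked_complex F(2) by blast
  then show ?thesis using sph F(1) unfolding stacked_sphere_def by blast
qed

section \<open>Stacked balls are trees of simplices\<close>

lemma rtranclp_crossing:
  assumes "r\<^sup>*\<^sup>* a b" "a \<in> S" "b \<notin> S"
  obtains x y where "x \<in> S" "y \<notin> S" "r x y"
  using assms by (induction arbitrary: thesis rule: rtranclp_induct) blast+

lemma stellated_simplex_boundary:
  assumes "finite V" "card V = m + 2"
  shows "stellated 1 (int m) (simplex_boundary V)"
  unfolding stellated_def using assms by (auto simp: face_dim_def)

lemma stellated_move:
  assumes "stellated 1 d X" "bistellar_move \<alpha> {v} X Y"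
  shows "stellated 1 d Y"
proof -
  obtain V where V: "finite V" "face_dim V = d + 1" and d: "1 \<le> d + 1"
    and rt: "(\<lambda>Y Z. \<exists>\<alpha> \<beta>. bistellar_move \<alpha> \<beta> Y Z \<and> face_dim \<beta> < 1)\<^sup>*\<^sup>* (simplex_boundary V) X"
    using assms(1) unfolding stellated_def by blast
  have "\<exists>\<alpha> \<beta>. bistellar_move \<alpha> \<beta> X Y \<and> face_dim \<beta> < 1"
    by (rule exI[of _ \<alpha>], rule exI[of _ "{v}"]) (simp add: assms(2) face_dim_def)
  then show ?thesis
    unfolding stellated_def using V d rtranclp.rtrancl_into_rtrancl[OF rt] by auto
qed

section \<open>Facets, ridges and the dual graph of a stacked ball\<close>

locale stacked_ball = coeff_field F for F :: "'f ring" (structure) +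
  fixes m :: nat and B :: "'a::linorder set set"
  assumes stacked: "F_stacked_ball F 1 (int m + 1) B"
begin

abbreviation bdB :: "'a set set" where "bdB \<equiv> ball_boundary F B"

definition facets :: "'a set set" where "facets = {T \<in> B. card T = m + 2}"

text \<open>The dual graph with a condition on the common ridge. Taking \<open>P\<close> as
  \<open>(\<subseteq>) \<sigma>\<close> gives the star of \<open>\<sigma>\<close>, inequality with a
  ridge deletes that edge of the graph, and \<open>(=) \<sigma>\<close> singles one out.\<close>

definition adj :: "('a set \<Rightarrow> bool) \<Rightarrow> 'a set \<Rightarrow> 'a set \<Rightarrow> bool" where
  "adj P A A' \<longleftrightarrow> A \<in> facets \<and> A' \<in> facets \<and> A \<noteq> A' \<and> card (A \<inter> A') = m + 1 \<and> P (A \<inter> A')"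

lemma B_complex: "simplicial_complex B"
  using stacked by (simp add: F_stacked_ball_def F_homology_ball_def)

lemma B_acyclic: "acyclic_complex F B"
  using stacked by (simp add: F_stacked_ball_def F_homology_ball_def)

lemma bdB_sphere: "F_homology_sphere F (int m) bdB"
  using stacked by (simp add: F_stacked_ball_def F_homology_ball_def)

lemma B_dim: "complex_dim B = int (m + 2) - 1"
  using stacked by (simp add: F_stacked_ball_def F_homology_ball_def)

lemma bdB_subset: "bdB \<subseteq> B"
  by (auto simp: ball_boundary_def)

lemma card_le: "\<sigma> \<in> B \<Longrightarrow> card \<sigma> \<le> m + 2"
  by (rule complex_dim_eqD(1)[OF B_complex B_dim])

lemma link_cases:
  assumes "\<sigma> \<in> B" "\<sigma> \<noteq> {}"
  shows "has_homology_of_sphere F (int m + 1 - int (card \<sigma>)) (link \<sigma> B) \<or> acyclic_complex F (link \<sigma> B)"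
proof -
  have "has_homology_of_sphere F (int m + 1 - face_dim \<sigma> - 1) (link \<sigma> B) \<or> acyclic_complex F (link \<sigma> B)"
    using stacked assms unfolding F_stacked_ball_def F_homology_ball_def by blast
  moreover have "int m + 1 - face_dim \<sigma> - 1 = int m + 1 - int (card \<sigma>)" by (simp add: face_dim_def)
  ultimately show ?thesis by simp
qed

lemma low_faces_in_bdB: "\<sigma> \<in> B \<Longrightarrow> card \<sigma> \<le> m \<Longrightarrow> \<sigma> \<in> bdB"
  using stacked by (simp add: F_stacked_ball_def face_dim_def)

lemma finite_facets: "finite facets"
  using B_complex by (simp add: facets_def simplicial_complex_def)

lemma facetD: "T \<in> facets \<Longrightarrow> T \<in> B \<and> card T = m + 2 \<and> finite T"
  using finite_face[OF B_complex] by (auto simp: facets_def)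

lemma link_facet: "T \<in> facets \<Longrightarrow> link T B = {{}}"
proof (rule link_maximal)
  fix \<tau> assume T: "T \<in> facets" and "\<tau> \<in> B" "T \<subseteq> \<tau>"
  then show "\<tau> = T"
    using card_seteq[of \<tau> T] card_le[of \<tau>] facetD[OF T] finite_face[OF B_complex] by auto
qed (use facetD B_complex in \<open>auto simp: simplicial_complex_def\<close>)

lemma facet_notin_bdB: "T \<in> facets \<Longrightarrow> T \<notin> bdB"
  using link_facet[of T] not_acyclic_empty[where 'a = 'a] by (simp add: ball_boundary_def)

text \<open>A maximal face has the (-1)-sphere as link. This is not acyclic, so the face satisfies
  the sphere condition, whose degree must be -1; this fixes its size as
  \<open>m + 2\<close>.\<close>

lemma in_facet:
  assumes "\<sigma> \<in> B"
  obtains T where "T \<in> facets" "\<sigma> \<subseteq> T"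
proof (cases "\<sigma> = {}")
  case True
  then show ?thesis using complex_dim_eqD(2)[OF B_complex B_dim] that by (auto simp: facets_def)
next
  case False
  have "finite {\<tau> \<in> B. \<sigma> \<subseteq> \<tau>}" using B_complex by (simp add: simplicial_complex_def)
  then obtain T where T: "T \<in> B" "\<sigma> \<subseteq> T" and max: "\<And>\<tau>. \<tau> \<in> B \<Longrightarrow> \<sigma> \<subseteq> \<tau> \<Longrightarrow> T \<subseteq> \<tau> \<Longrightarrow> T = \<tau>"
    using finite_has_maximal2[of "{\<tau> \<in> B. \<sigma> \<subseteq> \<tau>}" \<sigma>] assms by auto
  have lk: "link T B = {{}}"
    using T max face_subset[OF B_complex T(1), of "{}"] by (intro link_maximal) auto
  have "T \<noteq> {}" using T False by blast
  then have "int m + 1 - int (card T) = -1"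
    using link_cases[OF T(1)] not_acyclic_empty[where 'a = 'a] unfolding lk sphere_empty_iff by blast
  then have "card T = m + 2" by linarith
  then show ?thesis using T that by (simp add: facets_def)
qed

lemma facet_over_ridge:
  assumes "A \<in> facets" "\<rho> \<subseteq> A" "card \<rho> = m + 1"
  obtains x where "x \<notin> \<rho>" "A = insert x \<rho>"
proof -
  have A: "finite A" "card A = m + 2" using facetD[OF assms(1)] by auto
  then have "card (A - \<rho>) = 1" using assms by (simp add: card_Diff_subset finite_subset[OF assms(2)])
  then obtain x where "A - \<rho> = {x}" by (auto simp: card_1_singleton_iff)
  then show ?thesis using assms(2) that[of x] by blast
qed

lemma mem_link_ridge:
  assumes "card \<rho> = m + 1"
  shows "{x} \<in> link \<rho> B \<longleftrightarrow> x \<notin> \<rho> \<and> insert x \<rho> \<in> facets"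
proof
  have fin: "finite \<rho>" using assms by (intro card_ge_0_finite) simp
  show "x \<notin> \<rho> \<and> insert x \<rho> \<in> facets" if "{x} \<in> link \<rho> B"
    using that assms fin by (auto simp: link_def facets_def)
  show "{x} \<in> link \<rho> B" if "x \<notin> \<rho> \<and> insert x \<rho> \<in> facets"
    using that face_subset[OF B_complex, of "insert x \<rho>" "{x}"] by (auto simp: link_def facets_def)
qed

lemma link_ridge_dim0:
  assumes "\<rho> \<in> B" "card \<rho> = m + 1" "\<tau> \<in> link \<rho> B"
  shows "card \<tau> \<le> 1"
proof -
  have "card (\<tau> \<union> \<rho>) \<le> m + 2" "\<tau> \<inter> \<rho> = {}" "finite \<tau>" "finite \<rho>"
    using assms card_le finite_face[OF B_complex] by (auto simp: link_def)
  then show ?thesis using assms by (simp add: card_Un_disjoint)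
qed

text \<open>The link of a ridge has dimension at most 0, and its vertices correspond to the facets
  over the ridge. An acyclic one is a single point.\<close>

lemma boundary_ridge:
  assumes \<rho>: "\<rho> \<in> bdB" "card \<rho> = m + 1"
    and A: "A \<in> facets" "\<rho> \<subseteq> A" and A': "A' \<in> facets" "\<rho> \<subseteq> A'"
  shows "A = A'"
proof -
  have \<rho>B: "\<rho> \<in> B" and ac: "acyclic_complex F (link \<rho> B)" using \<rho> by (auto simp: ball_boundary_def)
  obtain p where p: "link \<rho> B = {{}, {p}}"
    using acyclic_dim0[OF simplicial_complex_link[OF B_complex \<rho>B] link_ridge_dim0[OF \<rho>B \<rho>(2)] ac] by blast
  have "C = insert p \<rho>" if C: "C \<in> facets" "\<rho> \<subseteq> C" for C
  proof -
    obtain x where x: "x \<notin> \<rho>" "C = insert x \<rho>" using facet_over_ridge[OF C \<rho>(2)] by blast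
    then have "{x} \<in> link \<rho> B" using mem_link_ridge[OF \<rho>(2)] C by blast
    then show ?thesis using p x by simp
  qed
  then show ?thesis using A A' by blast
qed

text \<open>The link is not acyclic, hence a 0-sphere of dimension at most 0, that is, two
  points.\<close>

lemma interior_ridge:
  assumes "\<rho> \<in> B" "\<rho> \<notin> bdB" "card \<rho> = m + 1"
  obtains A A' where "A \<in> facets" "A' \<in> facets" "A \<noteq> A'" "A \<inter> A' = \<rho>"
    "\<And>C. C \<in> facets \<Longrightarrow> \<rho> \<subseteq> C \<Longrightarrow> C = A \<or> C = A'"
proof -
  have ne: "\<rho> \<noteq> {}" using assms by auto
  have "has_homology_of_sphere F 0 (link \<rho> B)"
    using link_cases[OF assms(1) ne] assms by (simp add: ball_boundary_def)
  then obtain x y where xy: "x \<noteq> y" "link \<rho> B = {{}, {x}, {y}}"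
    using sphere_dim0[OF simplicial_complex_link[OF B_complex assms(1)] link_ridge_dim0[OF assms(1,3)]]
    by blast
  have *: "x \<notin> \<rho> \<and> insert x \<rho> \<in> facets" "y \<notin> \<rho> \<and> insert y \<rho> \<in> facets"
    using mem_link_ridge[OF assms(3), of x] mem_link_ridge[OF assms(3), of y] by (auto simp: xy(2))
  show ?thesis
  proof (rule that)
    show "insert x \<rho> \<in> facets" "insert y \<rho> \<in> facets" using * by auto
    show "insert x \<rho> \<noteq> insert y \<rho>" "insert x \<rho> \<inter> insert y \<rho> = \<rho>" using * xy(1) by auto
    fix C assume C: "C \<in> facets" "\<rho> \<subseteq> C"
    obtain p where p: "p \<notin> \<rho>" "C = insert p \<rho>" using facet_over_ridge[OF C assms(3)] by blast
    then have "{p} \<in> link \<rho> B" using mem_link_ridge[OF assms(3)] C by blast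
    then show "C = insert x \<rho> \<or> C = insert y \<rho>" using xy(2) p by auto
  qed
qed

text \<open>Two facets over a ridge keep it off the boundary by \<open>boundary_ridge\<close>, and
  then \<open>interior_ridge\<close> rules out a third.\<close>

lemma adj_ridge:
  assumes "adj P A A'"
  shows "A \<inter> A' \<in> B" "A \<inter> A' \<notin> bdB" "\<And>C. C \<in> facets \<Longrightarrow> A \<inter> A' \<subseteq> C \<Longrightarrow> C = A \<or> C = A'"
proof -
  have a: "A \<in> facets" "A' \<in> facets" "A \<noteq> A'" "card (A \<inter> A') = m + 1"
    using assms by (auto simp: adj_def)
  show B: "A \<inter> A' \<in> B" using facetD[OF a(1)] face_subset[OF B_complex, of A] by blast
  show n: "A \<inter> A' \<notin> bdB" using boundary_ridge[OF _ a(4,1) _ a(2)] a(3) by blast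
  show "C = A \<or> C = A'" if "C \<in> facets" "A \<inter> A' \<subseteq> C" for C
    using interior_ridge[OF B n a(4)] that a(1,2,3) by (metis inf_le1 inf_le2)
qed

lemma adj_mono: "(adj P)\<^sup>*\<^sup>* A A' \<Longrightarrow> (\<And>\<rho>. P \<rho> \<Longrightarrow> Q \<rho>) \<Longrightarrow> (adj Q)\<^sup>*\<^sup>* A A'"
  by (erule mono_rtranclp[rule_format, rotated]) (auto simp: adj_def)

text \<open>Downward induction on \<open>\<sigma>\<close>: the link of a face of codimension at least 2 is acyclic,
  hence connected, and its vertices lead to stars of larger faces.\<close>

lemma star_connected:
  assumes "\<sigma> \<in> B" "A \<in> facets" "A' \<in> facets" "\<sigma> \<subseteq> A" "\<sigma> \<subseteq> A'"
  shows "(adj ((\<subseteq>) \<sigma>))\<^sup>*\<^sup>* A A'"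
  using assms
proof (induction "m + 2 - card \<sigma>" arbitrary: \<sigma> A A' rule: less_induct)
  case less
  note A = facetD[OF less.prems(2)] and A' = facetD[OF less.prems(3)]
  have fin: "finite \<sigma>" using finite_face[OF B_complex less.prems(1)] .
  consider "card \<sigma> = m + 2" | "card \<sigma> = m + 1" | "card \<sigma> \<le> m"
    using card_le[OF less.prems(1)] by linarith
  then show ?case
  proof cases
    case 1
    then have "A = \<sigma>" "A' = \<sigma>" using card_subset_eq less.prems A A' by metis+
    then show ?thesis by simp
  next
    case 2
    show ?thesis
    proof (cases "A = A'")
      case False
      have "\<not> A \<subseteq> A'" using False A A' card_subset_eq[of A' A] by auto
      then have "A \<inter> A' \<subset> A" by blast
      then have "card (A \<inter> A') < m + 2" using A psubset_card_mono[of A "A \<inter> A'"] by simp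
      moreover have "m + 1 \<le> card (A \<inter> A')"
        using 2 card_mono[of "A \<inter> A'" \<sigma>] A less.prems by auto
      ultimately have "adj ((\<subseteq>) \<sigma>) A A'" using False less.prems by (simp add: adj_def)
      then show ?thesis by blast
    qed simp
  next
    case 3
    let ?L = "link \<sigma> B"
    have ac: "acyclic_complex F ?L"
      using low_faces_in_bdB[OF less.prems(1) 3] by (simp add: ball_boundary_def)
    have IH: "(adj ((\<subseteq>) \<sigma>))\<^sup>*\<^sup>* C C'"
      if "C \<in> facets" "C' \<in> facets" "insert x \<sigma> \<subseteq> C" "insert x \<sigma> \<subseteq> C'" "x \<notin> \<sigma>" for C C' x
    proof -
      have "insert x \<sigma> \<in> B" using that facetD face_subset[OF B_complex] by blast
      moreover have "m + 2 - card (insert x \<sigma>) < m + 2 - card \<sigma>" using fin that(5) 3 by simp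
      ultimately have "(adj ((\<subseteq>) (insert x \<sigma>)))\<^sup>*\<^sup>* C C'" using less.hyps that by blast
      then show ?thesis by (rule adj_mono) simp
    qed
    have vertex: "\<exists>x. x \<in> C \<and> x \<notin> \<sigma> \<and> {x} \<in> ?L" if C: "C \<in> facets" "\<sigma> \<subseteq> C" for C
    proof -
      have "\<not> C \<subseteq> \<sigma>" using card_mono[OF fin, of C] 3 facetD[OF C(1)] by auto
      then obtain x where x: "x \<in> C" "x \<notin> \<sigma>" by blast
      then have "{x} \<in> ?L"
        using C facetD[OF C(1)] face_subset[OF B_complex, of C "{x}"]
          face_subset[OF B_complex, of C "insert x \<sigma>"] by (auto simp: link_def)
      then show ?thesis using x by blast
    qed
    obtain u where u: "u \<in> A" "u \<notin> \<sigma>" "{u} \<in> ?L" using vertex less.prems by blast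
    obtain u' where u': "u' \<in> A'" "u' \<notin> \<sigma>" "{u'} \<in> ?L" using vertex less.prems by blast
    have "(\<lambda>a b. {a, b} \<in> ?L)\<^sup>*\<^sup>* u u'"
      by (rule acyclic_connected[OF simplicial_complex_link[OF B_complex less.prems(1)] ac u(3) u'(3)])
    \<comment> \<open>Quantifying over all facets that contain the current vertex makes the
      statement inductive along the path in the link.\<close>
    then have "\<forall>C\<in>facets. insert u' \<sigma> \<subseteq> C \<longrightarrow> (adj ((\<subseteq>) \<sigma>))\<^sup>*\<^sup>* A C"
    proof (induction rule: rtranclp_induct)
      case base
      show ?case using IH[of A _ u] less.prems u by blast
    next
      case (step a b)
      have ab: "{a, b} \<union> \<sigma> \<in> B" "a \<notin> \<sigma>" "b \<notin> \<sigma>" using step(2) by (auto simp: link_def)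
      obtain D where D: "D \<in> facets" "{a, b} \<union> \<sigma> \<subseteq> D" using in_facet[OF ab(1)] by blast
      have "(adj ((\<subseteq>) \<sigma>))\<^sup>*\<^sup>* A D" using step(3) D by blast
      \<comment> \<open>\<open>D\<close> contains both ends of the edge: it is reached through the
        star of \<open>a\<close> and left through the star of \<open>b\<close>.\<close>
      moreover have "(adj ((\<subseteq>) \<sigma>))\<^sup>*\<^sup>* D C" if "C \<in> facets" "insert b \<sigma> \<subseteq> C" for C
        using IH[of D C b] D ab that by blast
      ultimately show ?case by (meson rtranclp_trans)
    qed
    then show ?thesis using less.prems u' by blast
  qed
qed

section \<open>The fundamental chain, and interior ridges as bridges\<close>

lemma bdB_complex: "simplicial_complex bdB"
  using bdB_sphere by (simp add: F_homology_sphere_def)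

lemma bdB_homology: "has_homology_of_sphere F (int m) bdB"
proof -
  have "{} \<in> bdB" using bdB_complex by (simp add: simplicial_complex_def)
  then have "has_homology_of_sphere F (int m - face_dim ({} :: 'a set) - 1) (link {} bdB)"
    using bdB_sphere unfolding F_homology_sphere_def by blast
  then show ?thesis by (simp add: face_dim_def)
qed

text \<open>Only two facets lie over the ridge, so two terms of the boundary survive. The signs do
  not depend on the chain, which allows two chains to be compared at the same ridge.\<close>

lemma bd_at_ridge:
  assumes "adj P A A'"
  obtains s s' where "s \<in> carrier F" "s' \<in> carrier F" "s \<otimes> s = \<one>" "s' \<otimes> s' = \<one>"
    "\<And>e. is_chain B (int m + 1) e \<Longrightarrow> bd (\<Union>B) e (A \<inter> A') = s \<otimes> e A \<oplus> s' \<otimes> e A'"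
proof -
  let ?\<rho> = "A \<inter> A'"
  have a: "A \<in> facets" "A' \<in> facets" "A \<noteq> A'" "card ?\<rho> = m + 1"
    using assms by (auto simp: adj_def)
  obtain x where x: "x \<notin> ?\<rho>" "A = insert x ?\<rho>" using facet_over_ridge[OF a(1) _ a(4)] by blast
  obtain y where y: "y \<notin> ?\<rho>" "A' = insert y ?\<rho>" using facet_over_ridge[OF a(2) _ a(4)] by blast
  have xy: "x \<noteq> y" using x y a(3) by metis
  have "bd (\<Union>B) e ?\<rho> = sg ?\<rho> x \<otimes> e A \<oplus> sg ?\<rho> y \<otimes> e A'" if e: "is_chain B (int m + 1) e" for e
  proof -
    have cl: "e \<sigma> \<in> carrier F" for \<sigma> using is_chain_closed[OF e] .
    have "bd (\<Union>B) e ?\<rho> = bd {x, y} e ?\<rho>"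
    proof (rule bd_mono[OF cl])
      fix v assume v: "e (insert v ?\<rho>) \<noteq> \<zero>"
      then have "insert v ?\<rho> \<in> facets" using e by (auto simp: is_chain_def facets_def face_dim_def)
      then have "insert v ?\<rho> = A \<or> insert v ?\<rho> = A'" using adj_ridge(3)[OF assms] by blast
      then show "v \<in> ?\<rho> \<or> v \<in> {x, y}" using x y by blast
    next
      have "A \<in> B" "A' \<in> B" using a facetD by auto
      moreover have "x \<in> A" "y \<in> A'" using x(2) y(2) by blast+
      ultimately show "{x, y} \<subseteq> \<Union>B" by blast
      show "finite (\<Union>B)" by (rule finite_vertices[OF B_complex])
    qed
    also have "{x, y} - ?\<rho> = {x, y}" using x(1) y(1) by blast
    then have "bd {x, y} e ?\<rho> = (\<Oplus>v\<in>{x, y}. sg ?\<rho> v \<otimes> e (insert v ?\<rho>))" by (simp only: bd_def)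
    also have "\<dots> = sg ?\<rho> x \<otimes> e (insert x ?\<rho>) \<oplus> sg ?\<rho> y \<otimes> e (insert y ?\<rho>)"
      using xy cl by simp
    finally show ?thesis using x(2) y(2) by metis
  qed
  then show ?thesis using that[of "sg ?\<rho> x" "sg ?\<rho> y"] by simp
qed

text \<open>Where a boundary vanishes at an interior ridge, the values of the chain on the two
  facets differ by a factor that depends on the signs only.\<close>

lemma opposite_terms:
  assumes "s \<in> carrier F" "s' \<in> carrier F" "s \<otimes> s = \<one>" "a \<in> carrier F" "a' \<in> carrier F"
    and "s \<otimes> a \<oplus> s' \<otimes> a' = \<zero>"
  shows "a = \<ominus> (s \<otimes> s') \<otimes> a'"
proof -
  have "s \<otimes> a = \<ominus> (s' \<otimes> a')" using assms by (simp add: minus_equality)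
  then have "s \<otimes> (s \<otimes> a) = s \<otimes> \<ominus> (s' \<otimes> a')" by simp
  then have "(s \<otimes> s) \<otimes> a = \<ominus> (s \<otimes> s') \<otimes> a'"
    using assms(1,2,4,5) by (simp add: m_assoc l_minus r_minus)
  then show ?thesis using assms by simp
qed

lemma bounding_chain:
  assumes "is_cycle B i c"
  obtains e where "is_chain B (i + 1) e" "c = bd (\<Union>B) e"
  using B_acyclic acyclic_iff[OF B_complex] assms by (auto simp: is_bdry_def)

text \<open>A generator of the top homology of the boundary sphere is filled in the acyclic ball.
  The filling \<open>w\<close> is nonzero on some facet. Across an interior ridge its values are
  proportional, so nonvanishing spreads over the connected dual graph.\<close>

lemma fundamental_chain:
  obtains w where "is_chain B (int m + 1) w" "\<And>T. T \<in> facets \<Longrightarrow> w T \<noteq> \<zero>"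
    "\<And>\<rho>. \<rho> \<notin> bdB \<Longrightarrow> bd (\<Union>B) w \<rho> = \<zero>"
proof -
  have iso: "module_isomorphic F (reduced_homology F bdB (int m)) (self_module F)"
    using bdB_homology by (simp add: has_homology_of_sphere_def)
  obtain z where z: "is_cycle bdB (int m) z" "\<not> is_bdry bdB (int m) z"
    by (rule homology_generator[OF bdB_complex iso]) blast
  have zc: "is_chain bdB (int m) z" using z(1) by (simp add: is_cycle_def)
  have "is_cycle B (int m) z"
    using z(1) bd_subcomplex[OF B_complex bdB_subset zc] is_chain_mono[OF zc bdB_subset]
    by (simp add: is_cycle_def)
  then obtain w where w: "is_chain B (int m + 1) w" "z = bd (\<Union>B) w" by (rule bounding_chain)
  have cl: "w \<sigma> \<in> carrier F" for \<sigma> using is_chain_closed[OF w(1)] .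
  have bw: "bd (\<Union>B) w \<rho> = \<zero>" if "\<rho> \<notin> bdB" for \<rho>
    using that is_chain_zero[OF zc, of \<rho>] w(2) by simp
  have "\<exists>T. w T \<noteq> \<zero>"
  proof (rule ccontr)
    assume "\<not> ?thesis"
    then have "w = (\<lambda>\<sigma>. \<zero>)" by blast
    then have "z = (\<lambda>\<sigma>. \<zero>)" unfolding w(2) by (intro ext) simp
    then show False using z(2) is_bdry_0 by metis
  qed
  then obtain T0 where T0: "w T0 \<noteq> \<zero>" by blast
  then have T0f: "T0 \<in> facets" using w(1) by (auto simp: is_chain_def facets_def face_dim_def)
  have "w T \<noteq> \<zero>" if "T \<in> facets" for T
  proof -
    have "{} \<in> B" using B_complex by (simp add: simplicial_complex_def)
    then have "(adj ((\<subseteq>) {}))\<^sup>*\<^sup>* T0 T" using star_connected[of "{}" T0 T] T0f that by simp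
    then show ?thesis
    proof (induction rule: rtranclp_induct)
      case base
      show ?case by (rule T0)
    next
      case (step A A')
      obtain s s' where s: "s \<in> carrier F" "s' \<in> carrier F" "s \<otimes> s = \<one>"
        "bd (\<Union>B) w (A \<inter> A') = s \<otimes> w A \<oplus> s' \<otimes> w A'"
        using bd_at_ridge[OF step(2)] w(1) by metis
      then have "s \<otimes> w A \<oplus> s' \<otimes> w A' = \<zero>" using bw[OF adj_ridge(2)[OF step(2)]] by simp
      then have "w A = \<ominus> (s \<otimes> s') \<otimes> w A'" using opposite_terms[OF s(1-3) cl cl] by blast
      then show ?case using step(3) s(1,2) by auto
    qed
  qed
  then show ?thesis using that w(1) bw by blast
qed

text \<open>An interior ridge \<open>\<alpha>\<close> has its boundary in the sphere, where it bounds a chain \<open>c\<close>; the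
  chain filling \<open>\<alpha> - c\<close> is a constant multiple of the fundamental chain across every ridge
  except \<open>\<alpha>\<close>.\<close>

lemma interior_ridge_bridge:
  assumes adj: "adj P T T'"
  shows "\<not> (adj (\<lambda>\<rho>. \<rho> \<noteq> T \<inter> T'))\<^sup>*\<^sup>* T T'"
proof
  assume path: "(adj (\<lambda>\<rho>. \<rho> \<noteq> T \<inter> T'))\<^sup>*\<^sup>* T T'"
  let ?\<alpha> = "T \<inter> T'"
  have \<alpha>: "?\<alpha> \<in> B" "?\<alpha> \<notin> bdB" "card ?\<alpha> = m + 1" "T \<in> facets" "T' \<in> facets"
    using adj_ridge[OF adj] adj by (auto simp: adj_def)
  have fin\<alpha>: "finite ?\<alpha>" using finite_face[OF B_complex \<alpha>(1)] .
  note finU = finite_vertices[OF B_complex]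
  obtain w where w: "is_chain B (int m + 1) w" "\<And>T. T \<in> facets \<Longrightarrow> w T \<noteq> \<zero>"
    "\<And>\<rho>. \<rho> \<notin> bdB \<Longrightarrow> bd (\<Union>B) w \<rho> = \<zero>" by (rule fundamental_chain) blast
  have d: "is_chain B (int m) (delta ?\<alpha>)" using is_chain_delta[OF \<alpha>(1)] \<alpha>(3) by (simp add: face_dim_def)
  define b where "b = bd (\<Union>B) (delta ?\<alpha>)"
  have b: "is_chain B (int m - 1) b" unfolding b_def by (rule is_chain_bd[OF B_complex d])
  \<comment> \<open>Faces occurring in \<open>b\<close> have \<open>m\<close> vertices, that is,
    codimension 2 in the ball, and so lie in the boundary sphere. This is where 1-stackedness
    enters.\<close>
  have bX: "is_chain bdB (int m - 1) b"
    using b low_faces_in_bdB unfolding is_chain_def by (simp add: face_dim_def)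
  have "bd (\<Union>B) b \<tau> = \<zero>" for \<tau>
    unfolding b_def by (rule bd_bd[OF finU is_chain_supported[OF d]])
  then have "is_cycle bdB (int m - 1) b"
    using bX bd_subcomplex[OF B_complex bdB_subset bX] by (simp add: is_cycle_def)
  \<comment> \<open>The boundary is an \<open>m\<close>-sphere, so its homology one degree lower
    vanishes and \<open>b\<close> bounds inside it.\<close>
  moreover have "trivial_module (reduced_homology F bdB (int m - 1))"
    using bdB_homology unfolding has_homology_of_sphere_def by simp
  ultimately have "is_bdry bdB (int m - 1) b" using trivial_homology_iff[OF bdB_complex] by blast
  then obtain c where c: "is_chain bdB (int m) c" "b = bd (\<Union>bdB) c" by (auto simp: is_bdry_def)
  have cB: "is_chain B (int m) c" using is_chain_mono[OF c(1) bdB_subset] .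
  have bc: "bd (\<Union>B) c \<tau> = b \<tau>" for \<tau>
    using bd_subcomplex[OF B_complex bdB_subset c(1)] c(2) by simp
  define g where "g = (\<lambda>\<sigma>. delta ?\<alpha> \<sigma> \<ominus> c \<sigma>)"
  have "bd (\<Union>B) g \<tau> = \<zero>" for \<tau>
  proof -
    have "bd (\<Union>B) g \<tau> = bd (\<Union>B) (delta ?\<alpha>) \<tau> \<ominus> bd (\<Union>B) c \<tau>"
      unfolding g_def by (rule bd_minus[OF delta_closed is_chain_closed[OF cB] finU])
    then show ?thesis using is_chain_closed[OF b, of \<tau>] unfolding bc b_def by (simp only: r_neg a_minus_def)
  qed
  then have "is_cycle B (int m) g"
    unfolding is_cycle_def g_def using is_chain_minus[OF d cB] by blast
  then obtain e where e: "is_chain B (int m + 1) e" "g = bd (\<Union>B) e" by (rule bounding_chain)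
  have ecl: "e \<sigma> \<in> carrier F" and wcl: "w \<sigma> \<in> carrier F" for \<sigma>
    using is_chain_closed[OF e(1)] is_chain_closed[OF w(1)] by auto
  have g0: "bd (\<Union>B) e \<rho> = \<zero>" if "\<rho> \<notin> bdB" "\<rho> \<noteq> ?\<alpha>" for \<rho>
  proof -
    have "g \<rho> = \<zero> \<ominus> \<zero>" using that is_chain_zero[OF c(1), of \<rho>] by (simp add: g_def delta_def)
    then show ?thesis using e(2) by (simp add: a_minus_def)
  qed
  have g1: "bd (\<Union>B) e ?\<alpha> = \<one>"
  proof -
    have "g ?\<alpha> = \<one> \<ominus> \<zero>" using \<alpha>(2) is_chain_zero[OF c(1), of ?\<alpha>] by (simp add: g_def delta_def)
    then show ?thesis using e(2) by (simp add: a_minus_def)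
  qed
  \<comment> \<open>The quotient of \<open>e\<close> by \<open>w\<close> is constant along a path
    avoiding the ridge; cross-multiplication avoids dividing.\<close>
  from path have "e T' \<otimes> w T = e T \<otimes> w T'"
  proof (induction rule: rtranclp_induct)
    case base
    show ?case by simp
  next
    case (step A A')
    have A: "A \<in> facets" "A \<inter> A' \<noteq> ?\<alpha>" "A \<inter> A' \<notin> bdB"
      using step(2) adj_ridge(2)[OF step(2)] by (auto simp: adj_def)
    obtain s s' where s: "s \<in> carrier F" "s' \<in> carrier F" "s \<otimes> s = \<one>"
      "bd (\<Union>B) w (A \<inter> A') = s \<otimes> w A \<oplus> s' \<otimes> w A'" "bd (\<Union>B) e (A \<inter> A') = s \<otimes> e A \<oplus> s' \<otimes> e A'"
      using bd_at_ridge[OF step(2)] w(1) e(1) by metis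
    define t where "t = \<ominus> (s \<otimes> s')"
    have t: "t \<in> carrier F" using s by (simp add: t_def)
    have wA: "w A = t \<otimes> w A'"
      using opposite_terms[OF s(1-3) wcl wcl] s(4) w(3)[OF A(3)] by (simp add: t_def)
    have eA: "e A = t \<otimes> e A'"
      using opposite_terms[OF s(1-3) ecl ecl] s(5) g0[OF A(3,2)] by (simp add: t_def)
    have "t \<noteq> \<zero>" using wA w(2)[OF A(1)] wcl by auto
    moreover have "t \<otimes> (e A' \<otimes> w T) = t \<otimes> (e T \<otimes> w A')"
    proof -
      have "t \<otimes> (e A' \<otimes> w T) = e A \<otimes> w T" using t ecl wcl by (simp add: eA m_assoc)
      also have "\<dots> = e T \<otimes> (t \<otimes> w A')" using step(3) wA by simp
      also have "\<dots> = t \<otimes> (e T \<otimes> w A')" using t ecl wcl by (simp add: m_lcomm)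
      finally show ?thesis .
    qed
    ultimately show ?case using t ecl wcl m_lcancel[of t] by simp
  qed
  obtain s s' where s: "s \<in> carrier F" "s' \<in> carrier F" "s \<otimes> s = \<one>" "s' \<otimes> s' = \<one>"
    "bd (\<Union>B) w ?\<alpha> = s \<otimes> w T \<oplus> s' \<otimes> w T'" "bd (\<Union>B) e ?\<alpha> = s \<otimes> e T \<oplus> s' \<otimes> e T'"
    using bd_at_ridge[OF adj] w(1) e(1) by metis
  \<comment> \<open>If \<open>e\<close> and \<open>w\<close> are proportional on both facets over
    the ridge, their boundaries there are too. But the boundary of \<open>w\<close> is zero at the
    ridge and that of \<open>e\<close> is one.\<close>
  have "w T' \<otimes> (s \<otimes> e T \<oplus> s' \<otimes> e T') = s \<otimes> (e T \<otimes> w T') \<oplus> s' \<otimes> (e T' \<otimes> w T')"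
    using s(1,2) ecl wcl by (simp add: r_distr m_ac)
  also have "\<dots> = s \<otimes> (e T' \<otimes> w T) \<oplus> s' \<otimes> (e T' \<otimes> w T')"
    using \<open>e T' \<otimes> w T = e T \<otimes> w T'\<close> by simp
  also have "\<dots> = e T' \<otimes> (s \<otimes> w T \<oplus> s' \<otimes> w T')"
    using s(1,2) ecl wcl by (simp add: r_distr m_ac)
  also have "\<dots> = \<zero>" unfolding s(5)[symmetric] w(3)[OF \<alpha>(2)] using ecl by simp
  finally have "w T' = \<zero>" unfolding s(6)[symmetric] g1 using wcl by simp
  then show False using w(2)[OF \<alpha>(5)] by blast
qed

section \<open>Combinatorial boundary of a set of facets\<close>

definition bd_facets :: "'a set set \<Rightarrow> 'a set set" where
  "bd_facets S = {\<sigma>. (\<exists>T\<in>S. \<sigma> \<subset> T) \<and> \<not> (\<exists>A\<in>S. \<exists>A'\<in>S. adj ((=) \<sigma>) A A')}"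

text \<open>Faces of codimension at least 2 lie in both boundaries, on the homological side by
  stackedness. A ridge is interior exactly if two facets share it.\<close>

lemma bd_facets_all: "bd_facets facets = bdB"
proof (rule Set.set_eqI, rule iffI)
  fix \<sigma> assume \<sigma>: "\<sigma> \<in> bdB"
  then have "\<sigma> \<in> B" using bdB_subset by blast
  then obtain T where T: "T \<in> facets" "\<sigma> \<subseteq> T" by (rule in_facet)
  then have "\<sigma> \<subset> T" using facet_notin_bdB \<sigma> by blast
  moreover have "\<not> adj ((=) \<sigma>) A A'" for A A'
    using adj_ridge(2)[of "(=) \<sigma>" A A'] \<sigma> by (auto simp: adj_def)
  ultimately show "\<sigma> \<in> bd_facets facets" using T unfolding bd_facets_def by blast
next
  fix \<sigma> assume \<sigma>: "\<sigma> \<in> bd_facets facets"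
  then obtain T where T: "T \<in> facets" "\<sigma> \<subset> T" unfolding bd_facets_def by blast
  then have \<sigma>B: "\<sigma> \<in> B" using facetD face_subset[OF B_complex, of T \<sigma>] by blast
  have "card \<sigma> < m + 2" using psubset_card_mono[of T \<sigma>] T facetD[OF T(1)] by simp
  then consider "card \<sigma> \<le> m" | "card \<sigma> = m + 1" by linarith
  then show "\<sigma> \<in> bdB"
  proof cases
    case 2
    show ?thesis
    proof (rule ccontr)
      assume "\<sigma> \<notin> bdB"
      then obtain A A' where "A \<in> facets" "A' \<in> facets" "A \<noteq> A'" "A \<inter> A' = \<sigma>"
        using interior_ridge[OF \<sigma>B _ 2] by metis
      moreover from this have "adj ((=) \<sigma>) A A'" using 2 by (simp add: adj_def)
      ultimately show False using \<sigma> unfolding bd_facets_def by blast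
    qed
  qed (use low_faces_in_bdB[OF \<sigma>B] in blast)
qed

lemma bd_facets_single:
  assumes "T \<in> facets"
  shows "bd_facets {T} = simplex_boundary T"
  by (auto simp: bd_facets_def simplex_boundary_def adj_def)

text \<open>Only ridges can be excluded from the boundary, and a proper subset of a member has at
  most \<open>m\<close> elements, so it is never excluded.\<close>

lemma bd_facets_complex:
  assumes S: "S \<subseteq> facets" "S \<noteq> {}"
  shows "simplicial_complex (bd_facets S)" and "\<And>\<sigma>. \<sigma> \<in> bd_facets S \<Longrightarrow> card \<sigma> \<le> m + 1"
proof -
  have card: "card \<sigma> \<le> m + 1 \<and> finite \<sigma>" if \<sigma>: "\<sigma> \<in> bd_facets S" for \<sigma>
  proof -
    obtain T where T: "T \<in> S" "\<sigma> \<subset> T" using \<sigma> by (auto simp: bd_facets_def)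
    then have "card T = m + 2" "finite T" using S facetD by auto
    then show ?thesis using psubset_card_mono[of T \<sigma>] T(2) finite_subset[of \<sigma> T] by auto
  qed
  then show "\<And>\<sigma>. \<sigma> \<in> bd_facets S \<Longrightarrow> card \<sigma> \<le> m + 1" by blast
  have low: "\<sigma> \<in> bd_facets S" if "T \<in> S" "\<sigma> \<subset> T" "card \<sigma> \<le> m" for \<sigma> T
    using that unfolding bd_facets_def by (auto simp: adj_def)
  have down: "\<tau> \<in> bd_facets S" if \<sigma>: "\<sigma> \<in> bd_facets S" and "\<tau> \<subseteq> \<sigma>" for \<sigma> \<tau>
  proof (cases "\<tau> = \<sigma>")
    case False
    then have "\<tau> \<subset> \<sigma>" using that(2) by blast
    then have "card \<tau> \<le> m" using card[OF \<sigma>] psubset_card_mono[of \<sigma> \<tau>] by simp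
    moreover obtain T where "T \<in> S" "\<sigma> \<subset> T" using \<sigma> by (auto simp: bd_facets_def)
    ultimately show ?thesis using low[of T \<tau>] that by blast
  qed (use that in simp)
  have "finite (bd_facets S)"
  proof (rule finite_subset)
    show "bd_facets S \<subseteq> \<Union>(Pow ` facets)" using S(1) by (auto simp: bd_facets_def)
    show "finite (\<Union>(Pow ` facets))" using finite_facets facetD by auto
  qed
  moreover have "{} \<in> bd_facets S"
  proof -
    obtain T where T: "T \<in> S" using S by blast
    then have "T \<noteq> {}" using S facetD by fastforce
    then show ?thesis using low[OF T, of "{}"] by auto
  qed
  ultimately show "simplicial_complex (bd_facets S)"
    using card down unfolding simplicial_complex_def by blast
qed

text \<open>Because \<open>v\<close> is new, every facet of \<open>S\<close> meets \<open>T\<close>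
  inside \<open>T \<inter> T'\<close>. Hence this is the only ridge that becomes shared, and the
  boundary gains precisely the proper faces of \<open>T\<close> that contain
  \<open>v\<close>.\<close>

lemma bd_facets_move:
  assumes S: "S \<subseteq> facets" and T: "T \<in> facets" "T \<notin> S" and T': "T' \<in> S"
    and adj: "adj (\<lambda>_. True) T T'" and v: "T = insert v (T \<inter> T')" "v \<notin> \<Union>S"
  shows "bistellar_move (T \<inter> T') {v} (bd_facets S) (bd_facets (insert T S))"
proof -
  let ?\<alpha> = "T \<inter> T'"
  have ne: "S \<noteq> {}" using T' by blast
  note C = bd_facets_complex[OF S ne]
  have c\<alpha>: "card ?\<alpha> = m + 1" using adj by (simp add: adj_def)
  then have fin\<alpha>: "finite ?\<alpha>" by (intro card_ge_0_finite) simp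
  have T'f: "T' \<in> facets" using S T' by blast
  have v\<alpha>: "v \<notin> ?\<alpha>" using v(2) T' by blast
  have vT: "v \<in> T" using v(1) by blast
  have Tv: "T - {v} = ?\<alpha>" using v(1) v\<alpha> by (metis Diff_insert_absorb)
  have vS: "v \<notin> A" if "A \<in> S" for A using that v(2) by blast
  have \<alpha>T': "?\<alpha> \<subset> T'" using c\<alpha> facetD[OF T'f] by auto
  \<comment> \<open>Two facets of \<open>S\<close> sharing this ridge would be the only ones over
    it, but \<open>T\<close> contains it as well and is not in \<open>S\<close>.\<close>
  have \<alpha>no: "\<not> adj ((=) ?\<alpha>) A A'" if "A \<in> S" "A' \<in> S" for A A'
  proof
    assume a: "adj ((=) ?\<alpha>) A A'"
    then have "A \<inter> A' \<subseteq> T" by (auto simp: adj_def)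
    then have "T = A \<or> T = A'" using adj_ridge(3)[OF a T(1)] by blast
    then show False using that T(2) by blast
  qed
  have \<alpha>mem: "?\<alpha> \<in> bd_facets S" using \<alpha>T' T' \<alpha>no unfolding bd_facets_def by blast
  have vbd: "v \<notin> \<Union>(bd_facets S)" using v(2) by (auto simp: bd_facets_def)
  have dim: "face_dim ?\<alpha> = complex_dim (bd_facets S)"
  proof -
    have "finite (bd_facets S)" using C(1) by (simp add: simplicial_complex_def)
    then have "complex_dim (bd_facets S) = int (m + 1) - 1"
      using complex_dim_eqI[OF _ C(2) \<alpha>mem c\<alpha>] by blast
    then show ?thesis using c\<alpha> by (simp add: face_dim_def)
  qed
  \<comment> \<open>The common ridge avoids \<open>v\<close>, so it lies in
    \<open>T \<inter> T'\<close>, and equal cardinality forces equality.\<close>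
  have new_adj: "\<sigma> = ?\<alpha>" if "adj ((=) \<sigma>) T A \<or> adj ((=) \<sigma>) A T" "A \<in> S" for \<sigma> A
  proof -
    have \<sigma>: "\<sigma> = T \<inter> A" "card \<sigma> = m + 1" using that(1) by (auto simp: adj_def)
    have "\<sigma> \<subseteq> ?\<alpha>"
    proof
      fix x assume "x \<in> \<sigma>"
      then have "x \<in> T" "x \<noteq> v" using \<sigma>(1) vS[OF that(2)] by auto
      then show "x \<in> ?\<alpha>" using v(1) by (metis insertE)
    qed
    then show ?thesis using card_subset_eq[OF fin\<alpha>] \<sigma>(2) c\<alpha> by simp
  qed
  have "bd_facets (insert T S) = bd_facets S - {?\<alpha>} \<union> insert v ` {\<rho>. \<rho> \<subset> ?\<alpha>}"
  proof (rule Set.set_eqI)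
    fix \<sigma>
    show "\<sigma> \<in> bd_facets (insert T S) \<longleftrightarrow> \<sigma> \<in> bd_facets S - {?\<alpha>} \<union> insert v ` {\<rho>. \<rho> \<subset> ?\<alpha>}"
    proof (cases "v \<in> \<sigma>")
      case True
      have nS: "\<sigma> \<notin> bd_facets S" using True vbd by blast
      have "\<not> adj ((=) \<sigma>) A A'" if "A \<in> insert T S" "A' \<in> insert T S" for A A'
      proof
        assume a: "adj ((=) \<sigma>) A A'"
        then have "v \<in> A" "v \<in> A'" "A \<noteq> A'" using True by (auto simp: adj_def)
        then show False using that vS by blast
      qed
      then have "\<sigma> \<in> bd_facets (insert T S) \<longleftrightarrow> (\<exists>A\<in>insert T S. \<sigma> \<subset> A)"
        unfolding bd_facets_def by blast
      also have "\<dots> \<longleftrightarrow> \<sigma> \<subset> T" using True vS by blast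
      also have "\<dots> \<longleftrightarrow> \<sigma> \<in> insert v ` {\<rho>. \<rho> \<subset> ?\<alpha>}"
      proof
        assume "\<sigma> \<subset> T"
        then have "\<sigma> - {v} \<subset> T - {v}" using True by blast
        moreover note Tv
        moreover have "\<sigma> = insert v (\<sigma> - {v})" using True by blast
        ultimately show "\<sigma> \<in> insert v ` {\<rho>. \<rho> \<subset> ?\<alpha>}" by (intro image_eqI[of _ _ "\<sigma> - {v}"]) simp_all
      next
        assume "\<sigma> \<in> insert v ` {\<rho>. \<rho> \<subset> ?\<alpha>}"
        then obtain \<rho> where "\<rho> \<subset> ?\<alpha>" "\<sigma> = insert v \<rho>" by blast
        moreover have "\<rho> \<noteq> ?\<alpha>" "v \<notin> \<rho>" using calculation v\<alpha> by auto
        ultimately show "\<sigma> \<subset> T" using vT v\<alpha> by blast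
      qed
      finally show ?thesis using nS by blast
    next
      case False
      then have im: "\<sigma> \<notin> insert v ` {\<rho>. \<rho> \<subset> ?\<alpha>}" by blast
      have "\<sigma> \<subset> T'" if "\<sigma> \<subset> T"
      proof -
        have "\<sigma> \<subseteq> T - {v}" using that False by blast
        then show ?thesis unfolding Tv using \<alpha>T' by blast
      qed
      then have sub: "(\<exists>A\<in>insert T S. \<sigma> \<subset> A) \<longleftrightarrow> (\<exists>A\<in>S. \<sigma> \<subset> A)" using T' by blast
      show ?thesis
      proof (cases "\<sigma> = ?\<alpha>")
        case True
        have "adj ((=) \<sigma>) T T'" using adj True by (simp add: adj_def)
        then have "\<sigma> \<notin> bd_facets (insert T S)" using T' unfolding bd_facets_def by blast
        then show ?thesis using im True by blast
      next
        case ne: False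
        have "\<not> adj ((=) \<sigma>) T T" by (simp add: adj_def)
        then have "(\<exists>A\<in>insert T S. \<exists>A'\<in>insert T S. adj ((=) \<sigma>) A A') \<longleftrightarrow>
            (\<exists>A\<in>S. \<exists>A'\<in>S. adj ((=) \<sigma>) A A')"
          using new_adj[of \<sigma>] ne by blast
        then have "\<sigma> \<in> bd_facets (insert T S) \<longleftrightarrow> \<sigma> \<in> bd_facets S"
          using sub unfolding bd_facets_def by blast
        then show ?thesis using im ne by blast
      qed
    qed
  qed
  moreover have "?\<alpha> \<noteq> {}" using c\<alpha> by auto
  ultimately show ?thesis
    unfolding bistellar_move_vertex_iff using C(1) \<alpha>mem dim vbd by simp
qed

section \<open>Growing a connected set of facets to the whole ball\<close>

definition connected_facets :: "'a set set \<Rightarrow> bool" where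
  "connected_facets S \<longleftrightarrow> (\<forall>A\<in>S. \<forall>A'\<in>S. (\<lambda>C C'. C \<in> S \<and> C' \<in> S \<and> adj (\<lambda>_. True) C C')\<^sup>*\<^sup>* A A')"

lemma adj_sym: "adj P A A' \<Longrightarrow> adj P A' A"
  by (auto simp: adj_def Int_commute)

text \<open>A dual path from \<open>S\<close> to a facet outside crosses into some \<open>T\<close>,
  attached along a ridge to \<open>T'\<close> in \<open>S\<close>. That the vertex of
  \<open>T\<close> off this ridge is new follows from the bridge property. Connectedness of
  \<open>S\<close> is kept as an invariant to supply part of the forbidden path.\<close>

lemma grow_facets:
  assumes S: "S \<subseteq> facets" "S \<noteq> {}" "S \<noteq> facets" and conn: "connected_facets S"
    and st: "stellated 1 (int m) (bd_facets S)"
  obtains T where "T \<in> facets" "T \<notin> S" "connected_facets (insert T S)"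
    "stellated 1 (int m) (bd_facets (insert T S))"
proof -
  obtain T0 T1 where T01: "T0 \<in> S" "T1 \<in> facets" "T1 \<notin> S" using S by blast
  have "{} \<in> B" using B_complex by (simp add: simplicial_complex_def)
  then have path: "(adj ((\<subseteq>) {}))\<^sup>*\<^sup>* T0 T1"
    using star_connected[of "{}" T0 T1] T01 S(1) by auto
  obtain T' T where T: "T' \<in> S" "T \<notin> S" "adj ((\<subseteq>) {}) T' T"
    by (rule rtranclp_crossing[OF path T01(1,3)])
  then have adj: "adj (\<lambda>_. True) T T'" by (auto simp: adj_def Int_commute)
  have Tf: "T \<in> facets" "T' \<in> facets" "card (T \<inter> T') = m + 1" using adj by (auto simp: adj_def)
  obtain v where v: "v \<notin> T \<inter> T'" "T = insert v (T \<inter> T')"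
    using facet_over_ridge[OF Tf(1) _ Tf(3)] by blast
  have "v \<notin> \<Union>S"
  proof
    assume "v \<in> \<Union>S"
    then obtain C where C: "C \<in> S" "v \<in> C" by blast
    have vT: "v \<in> T" using v(2) by blast
    then have "{v} \<in> B" using facetD[OF Tf(1)] face_subset[OF B_complex, of T "{v}"] by blast
    \<comment> \<open>All ridges crossed inside the star of \<open>v\<close> contain
      \<open>v\<close>, hence none of them is \<open>T \<inter> T'\<close>.\<close>
    then have "(adj ((\<subseteq>) {v}))\<^sup>*\<^sup>* T C"
      using star_connected[of "{v}" T C] Tf(1) C S(1) vT by blast
    then have 1: "(adj (\<lambda>\<rho>. \<rho> \<noteq> T \<inter> T'))\<^sup>*\<^sup>* T C" by (rule adj_mono) (use v(1) in blast)
    have "(\<lambda>C C'. C \<in> S \<and> C' \<in> S \<and> adj (\<lambda>_. True) C C')\<^sup>*\<^sup>* C T'"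
      using conn C(1) T(1) unfolding connected_facets_def by blast
    then have "(adj (\<lambda>\<rho>. \<rho> \<noteq> T \<inter> T'))\<^sup>*\<^sup>* C T'"
    proof (rule mono_rtranclp[rule_format, rotated])
      fix A A' assume a: "A \<in> S \<and> A' \<in> S \<and> adj (\<lambda>_. True) A A'"
      \<comment> \<open>A step inside \<open>S\<close> across this ridge would need \<open>T\<close>
        as one of its two facets.\<close>
      have "A \<inter> A' \<noteq> T \<inter> T'"
      proof
        assume "A \<inter> A' = T \<inter> T'"
        then have "T = A \<or> T = A'" using adj_ridge(3)[of "\<lambda>_. True" A A' T] a Tf(1) by blast
        then show False using a T(2) by blast
      qed
      then show "adj (\<lambda>\<rho>. \<rho> \<noteq> T \<inter> T') A A'" using a by (simp add: adj_def)
    qed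
    with 1 have "(adj (\<lambda>\<rho>. \<rho> \<noteq> T \<inter> T'))\<^sup>*\<^sup>* T T'" by (rule rtranclp_trans)
    then show False using interior_ridge_bridge[OF adj] by blast
  qed
  then have st': "stellated 1 (int m) (bd_facets (insert T S))"
    using stellated_move[OF st bd_facets_move[OF S(1) Tf(1) T(2,1) adj v(2)]] by blast
  have "connected_facets (insert T S)"
    unfolding connected_facets_def
  proof (intro ballI)
    let ?r = "\<lambda>C C'. C \<in> insert T S \<and> C' \<in> insert T S \<and> adj (\<lambda>_. True) C C'"
    have old: "?r\<^sup>*\<^sup>* A A'" if "A \<in> S" "A' \<in> S" for A A'
    proof -
      have "(\<lambda>C C'. C \<in> S \<and> C' \<in> S \<and> adj (\<lambda>_. True) C C')\<^sup>*\<^sup>* A A'"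
        using conn that unfolding connected_facets_def by blast
      then show ?thesis by (rule mono_rtranclp[rule_format, rotated]) blast
    qed
    have TT': "?r T T'" "?r T' T" using adj adj_sym T(1) by auto
    fix A A' assume "A \<in> insert T S" "A' \<in> insert T S"
    then consider "A = T" "A' = T" | "A = T" "A' \<in> S" | "A \<in> S" "A' = T" | "A \<in> S" "A' \<in> S" by blast
    then show "?r\<^sup>*\<^sup>* A A'"
    proof cases
      case 1
      then show ?thesis by simp
    next
      case 2
      then show ?thesis using converse_rtranclp_into_rtranclp[of ?r, OF TT'(1) old[OF T(1)]] by blast
    next
      case 3
      then show ?thesis using rtranclp.rtrancl_into_rtrancl[of ?r, OF old[OF _ T(1)] TT'(2)] by blast
    next
      case 4
      then show ?thesis by (rule old)
    qed
  qed
  then show ?thesis using that Tf(1) T(2) st' by blast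
qed

text \<open>A maximal connected set of facets with stellated boundary exists, starting from a single
  facet, and \<open>grow_facets\<close> forces it to contain all facets.\<close>

lemma stellated_bdB: "stellated 1 (int m) bdB"
proof -
  define \<S> where "\<S> = {S. S \<subseteq> facets \<and> S \<noteq> {} \<and> connected_facets S \<and> stellated 1 (int m) (bd_facets S)}"
  have "\<S> \<subseteq> Pow facets" by (auto simp: \<S>_def)
  then have "finite \<S>" using finite_facets finite_subset finite_Pow_iff by metis
  moreover obtain T where T: "T \<in> facets"
    using in_facet[of "{}"] B_complex by (auto simp: simplicial_complex_def)
  then have "{T} \<in> \<S>"
    using stellated_simplex_boundary[of T m] facetD[OF T]
    by (simp add: \<S>_def bd_facets_single connected_facets_def)
  then have "\<S> \<noteq> {}" by blast
  ultimately obtain S where S: "S \<in> \<S>" and max: "\<And>S'. S' \<in> \<S> \<Longrightarrow> S \<subseteq> S' \<Longrightarrow> S = S'"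
    using finite_has_maximal[of \<S>] by blast
  have "S = facets"
  proof (rule ccontr)
    assume ne: "S \<noteq> facets"
    obtain T where "T \<in> facets" "T \<notin> S" "connected_facets (insert T S)"
      "stellated 1 (int m) (bd_facets (insert T S))"
      using grow_facets[of S] S ne unfolding \<S>_def by blast
    then have "insert T S \<in> \<S>" using S by (simp add: \<S>_def)
    then show False using max[of "insert T S"] \<open>T \<notin> S\<close> by blast
  qed
  then show ?thesis using S bd_facets_all by (simp add: \<S>_def)
qed

end

text \<open>The argument runs over the field of the ball, which \<open>stacked_sphere\<close> does
  not tie to the field over which \<open>X\<close> is a sphere.\<close>

lemma stacked_imp_stellated:
  fixes X :: "'a::linorder set set"
  assumes "stacked_sphere TYPE('f) 1 (int m) X"
  shows "stellated 1 (int m) X"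
proof -
  obtain F :: "'f ring" and B where F: "field F" "F_stacked_ball F 1 (int m + 1) B" "X = ball_boundary F B"
    using assms unfolding stacked_sphere_def by blast
  interpret stacked_ball F m B
    using F by (intro stacked_ball.intro coeff_field.intro stacked_ball_axioms.intro)
  show ?thesis unfolding F(3) by (rule stellated_bdB)
qed

theorem corollary2p15:
  fixes X :: "'a::linorder set set" and d :: int
  assumes "0 \<le> d"
    and "homology_sphere TYPE('f) d X"
  shows "stellated 1 d X \<longleftrightarrow> stacked_sphere TYPE('f) 1 d X"
proof -
  \<comment> \<open>A natural number in place of \<open>d\<close> lets the combinatorial part count
    vertices: \<open>m + 2\<close> in a facet of the ball, \<open>m + 1\<close> in a ridge.\<close>
  obtain m where d: "d = int m" using assms(1) nonneg_int_cases by blast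
  show ?thesis
    using stellated_imp_stacked[OF assms(2)[unfolded d]] stacked_imp_stellated[of m X] unfolding d by blast
qed

end
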